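(* For every integer $n\ge 0$ and every $r\in\{68,132\}$, $$v_0(160n+r)\equiv 0\pmod{25}.$$
   Context: The integer sequence $v_0(n)$, $n\ge 0$, is defined by the generating function (formal power series in $q$) $$\sum_{n=0}^\infty v_0(n)q^n=\sum_{n=0}^\infty \frac{q^{n^2}(-q;q^2)_n}{(q;q^2)_n},$$ where $(a;q)_0=1$ and $(a;q)_n=\prod_{i=1}^n(1-aq^{i-1})$ for $n\ge1$, so that $(-q;q^2)_n=\prod_{i=1}^n(1+q^{2i-1})$ and $(q;q^2)_n=\prod_{i=1}^n(1-q^{2i-1})$. *)

theory Defs
  imports "HOL-Computational_Algebra.Formal_Power_Series" "HOL-Number_Theory.Cong"
begin

definition qpoch :: "'a::comm_ring_1 \<Rightarrow> 'a \<Rightarrow> nat \<Rightarrow> 'a" where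
  "qpoch a q n = (\<Prod>i=1..n. 1 - a * q ^ (i - 1))"

text \<open>
  With \<open>q = fps_X\<close>, the \<open>n\<close>-th summand is \<open>q^(n^2) (-q;q^2)_n / (q;q^2)_n\<close>, taken in the integral
  power series. The type \<open>int fps\<close> has no division, but \<open>(q;q^2)_n\<close> has constant term 1 and
  \<open>fps_right_inverse f 1\<close> is then its reciprocal, see \<open>qpoch_mult_right_inverse\<close>.
\<close>

definition v0_term :: "nat \<Rightarrow> int fps" where
  "v0_term n = fps_X ^ (n ^ 2) * qpoch (- fps_X) (fps_X ^ 2) n *
     fps_right_inverse (qpoch fps_X (fps_X ^ 2) n) 1"

text \<open>
  The infinite sum is the limit in the metric topology of formal power series; it converges by
  \<open>summable_v0_term\<close>.
\<close>

definition v0 :: "nat \<Rightarrow> int" where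
  "v0 n = fps_nth (\<Sum>k. v0_term k) n"

lemma qpoch_mult_right_inverse:
  "qpoch fps_X (fps_X ^ 2) n * fps_right_inverse (qpoch fps_X (fps_X ^ 2) n) 1 = (1 :: int fps)"
proof (rule fps_right_inverse)
  have "fps_nth (qpoch fps_X (fps_X ^ 2) n) 0 = (1 :: int)"
    unfolding qpoch_def by (induction n) simp_all
  then show "fps_nth (qpoch fps_X (fps_X ^ 2) n) 0 * 1 = (1 :: int)" by simp
qed

lemma v0_term_nth_eq_0:
  assumes "m < n"
  shows "fps_nth (v0_term n) m = 0"
proof -
  have "m < n ^ 2" using assms by (metis le_square less_le_trans power2_eq_square)
  then show ?thesis by (simp add: v0_term_def mult.assoc fps_X_power_mult_nth)
qed

lemma summable_v0_term: "summable v0_term"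
proof -
  have "(\<lambda>N. \<Sum>n<N. v0_term n) \<longlonglongrightarrow> Abs_fps (\<lambda>m. \<Sum>n\<le>m. fps_nth (v0_term n) m)"
  proof (rule tendsto_fpsI)
    fix m
    have "fps_nth (\<Sum>n<N. v0_term n) m = (\<Sum>n\<le>m. fps_nth (v0_term n) m)" if "N > m" for N
      unfolding fps_sum_nth using that
      by (intro sum.mono_neutral_right) (auto simp: v0_term_nth_eq_0)
    then show "\<forall>\<^sub>F N in sequentially. fps_nth (\<Sum>n<N. v0_term n) m =
        fps_nth (Abs_fps (\<lambda>m. \<Sum>n\<le>m. fps_nth (v0_term n) m)) m"
      by (intro eventually_mono[OF eventually_gt_at_top[of m]]) simp
  qed
  then show ?thesis unfolding summable_def sums_def by blast
qed

end

theory Submission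
  imports Defs
begin

unbundle fps_syntax

text \<open>
  Let \<open>V(q) = \<Sum> v0(n) q^n\<close>, \<open>\<phi>(q) = 1 + 2 \<Sum> q^(n^2)\<close>, \<open>\<psi>(q) = \<Sum> q^(n(n+1)/2)\<close> and
  \<open>f(q) = \<Prod> (1 - q^n)\<close>. The series \<open>V(q) + V(-q) - 1\<close> is a bilateral sum. Inserting a parameter
  \<open>k\<close> turns it into a sequence \<open>T_k\<close> which by telescoping satisfies
  \<open>(1 - q^(4k+2)) T_k = (1 + q^(4k+2)) T_(k+1)\<close> and tends to \<open>\<phi>(q^2)\<close>; hence it equals
  \<open>\<phi>(q^2)^2 / \<phi>(-q^4)\<close>. Since \<open>1/\<phi>(-q) = \<phi>(q) / \<phi>(-q^2)^2\<close>, repeated 2-dissection by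
  \<open>\<phi>(q) = \<phi>(q^4) + 2q \<psi>(q^8)\<close> and \<open>\<phi>(q)^2 = \<phi>(q^2)^2 + 4q \<psi>(q^4)^2\<close> yields
  \<open>\<Sum> 2 v0(32n+4) q^n = 6 \<psi>(q) + 1024 q \<psi>(q)^9 / \<phi>(-q)^8 = 6 \<psi>(q) + 1024 q f(q^2)^26 / f(q)^25\<close>.
  Modulo 25, \<open>f(q)^25\<close> is \<open>f(q^5)^5\<close>, so only \<open>\<psi>(q)\<close> and \<open>q f(q^2)\<close> matter for the exponents modulo 5.
  By the pentagonal number theorem, neither has exponents congruent to 2 or 4 modulo 5, and
  \<open>160n + 68 = 32(5n+2) + 4\<close>, \<open>160n + 132 = 32(5n+4) + 4\<close>.
\<close>

section \<open>Formal power series: limits, dilation and sections\<close>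

lemma tendsto_fps_mult:
  fixes a b :: "'a::ring fps"
  assumes "(f \<longlongrightarrow> a) F" "(g \<longlongrightarrow> b) F"
  shows "((\<lambda>x. f x * g x) \<longlongrightarrow> a * b) F"
proof (rule tendsto_fpsI)
  fix n
  have "\<forall>\<^sub>F x in F. \<forall>i\<in>{..n}. f x $ i = a $ i \<and> g x $ i = b $ i"
    using assms unfolding tendsto_fps_iff
    by (subst eventually_ball_finite_distrib) (auto intro: eventually_conj)
  then show "\<forall>\<^sub>F x in F. (f x * g x) $ n = (a * b) $ n"
    by eventually_elim (simp add: fps_mult_nth)
qed

lemma tendsto_fps_add:
  fixes a b :: "'a::ab_group_add fps"
  assumes "(f \<longlongrightarrow> a) F" "(g \<longlongrightarrow> b) F"
  shows "((\<lambda>x. f x + g x) \<longlongrightarrow> a + b) F"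
proof (rule tendsto_fpsI)
  fix n
  show "\<forall>\<^sub>F x in F. (f x + g x) $ n = (a + b) $ n"
    using assms[unfolded tendsto_fps_iff, rule_format, of n] by eventually_elim simp
qed

lemma tendsto_fps_power:
  fixes a :: "'a::ring_1 fps"
  assumes "(f \<longlongrightarrow> a) F"
  shows "((\<lambda>x. f x ^ m) \<longlongrightarrow> a ^ m) F"
  by (induction m) (auto intro!: tendsto_fps_mult assms)

lemma fps_X_power_dvd_iff:
  fixes f :: "'a::comm_ring_1 fps"
  shows "fps_X ^ n dvd f \<longleftrightarrow> (\<forall>m<n. f $ m = 0)"
proof
  assume "\<forall>m<n. f $ m = 0"
  then have "f = fps_X ^ n * fps_shift n f"
    by (auto simp: fps_eq_iff fps_X_power_mult_nth)
  then show "fps_X ^ n dvd f" by (rule dvdI)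
qed (auto simp: fps_X_power_mult_nth elim!: dvdE)

lemma tendsto_fps_close:
  fixes a :: "'a::comm_ring_1 fps"
  assumes "g \<longlonglongrightarrow> a" "\<And>n. fps_X ^ n dvd f n - g n"
  shows "f \<longlonglongrightarrow> a"
proof (rule tendsto_fpsI)
  fix m
  have "f n $ m = g n $ m" if "n > m" for n
    using assms(2)[of n] that by (auto simp: fps_X_power_dvd_iff)
  then show "\<forall>\<^sub>F n in sequentially. f n $ m = a $ m"
    using eventually_conj[OF assms(1)[unfolded tendsto_fps_iff, rule_format, of m]
        eventually_gt_at_top[of m]] by (auto elim!: eventually_mono)
qed

lemma filterlim_subseq_mult:
  assumes "f \<longlonglongrightarrow> a" "k > 0"
  shows "(\<lambda>n::nat. f (k * n)) \<longlonglongrightarrow> a"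
  using LIMSEQ_subseq_LIMSEQ[OF assms(1), of "\<lambda>n. k * n"] assms(2)
  by (simp add: o_def strict_mono_def)

lemma tendsto_fps_compose:
  fixes a :: "'a::ring_1 fps"
  assumes "(f \<longlongrightarrow> a) F"
  shows "((\<lambda>x. f x oo g) \<longlongrightarrow> a oo g) F"
proof (rule tendsto_fpsI)
  fix n
  have "\<forall>\<^sub>F x in F. \<forall>i\<in>{..n}. f x $ i = a $ i"
    using assms unfolding tendsto_fps_iff
    by (subst eventually_ball_finite_distrib) auto
  then show "\<forall>\<^sub>F x in F. (f x oo g) $ n = (a oo g) $ n"
    by eventually_elim (simp add: fps_compose_nth)
qed

lemma sums_fps:
  fixes f :: "nat \<Rightarrow> 'a::comm_ring_1 fps"
  assumes "\<And>n. fps_X ^ n dvd f n"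
  shows "f sums Abs_fps (\<lambda>m. \<Sum>n\<le>m. f n $ m)"
  unfolding sums_def
proof (rule tendsto_fpsI)
  fix m
  have "fps_nth (\<Sum>n<N. f n) m = (\<Sum>n\<le>m. f n $ m)" if "N > m" for N
    unfolding fps_sum_nth using that assms
    by (intro sum.mono_neutral_right) (auto simp: fps_X_power_dvd_iff)
  then show "\<forall>\<^sub>F N in sequentially. fps_nth (\<Sum>n<N. f n) m =
      fps_nth (Abs_fps (\<lambda>m. \<Sum>n\<le>m. f n $ m)) m"
    by (intro eventually_mono[OF eventually_gt_at_top[of m]]) simp
qed

lemma suminf_fps_nth:
  fixes f :: "nat \<Rightarrow> 'a::comm_ring_1 fps"
  assumes "\<And>n. fps_X ^ n dvd f n"
  shows "suminf f $ m = (\<Sum>n\<le>m. f n $ m)"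
  using sums_unique[OF sums_fps[OF assms], symmetric] by simp

text \<open>Coefficient \<open>m\<close> is read off the product of the first \<open>m\<close>
  factors. If factor \<open>i\<close> is 1 modulo \<open>q^(i+1)\<close>, later factors no longer
  change it and this is the limit of the partial products.\<close>

definition fps_inf_prod :: "(nat \<Rightarrow> 'a::comm_ring_1 fps) \<Rightarrow> 'a fps" where
  "fps_inf_prod f = Abs_fps (\<lambda>m. (\<Prod>i<m. f i) $ m)"

lemma tendsto_fps_inf_prod:
  fixes f :: "nat \<Rightarrow> 'a::comm_ring_1 fps"
  assumes "\<And>i. fps_X ^ Suc i dvd f i - 1"
  shows "(\<lambda>N. \<Prod>i<N. f i) \<longlonglongrightarrow> fps_inf_prod f"
proof (rule tendsto_fpsI)
  fix m
  have "(\<Prod>i<N. f i) $ m = (\<Prod>i<m. f i) $ m" if "N \<ge> m" for N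
    using that
  proof (induction N rule: dec_induct)
    case (step N)
    have "fps_X ^ Suc N dvd (\<Prod>i<Suc N. f i) - (\<Prod>i<N. f i)"
      using dvd_mult[OF assms[of N], of "\<Prod>i<N. f i"] by (simp add: algebra_simps)
    then show ?case using step by (auto simp: fps_X_power_dvd_iff simp del: power_Suc)
  qed simp
  then show "\<forall>\<^sub>F N in sequentially. (\<Prod>i<N. f i) $ m = fps_inf_prod f $ m"
    unfolding fps_inf_prod_def fps_nth_Abs_fps
    by (rule eventually_mono[OF eventually_ge_at_top[of m]])
qed

section \<open>Dilation \<open>f(q^k)\<close> and extraction of residue classes of exponents\<close>

definition fps_dilate :: "nat \<Rightarrow> int fps \<Rightarrow> int fps" where
  "fps_dilate k f = f oo fps_X ^ k"

lemma fps_dilate_nth: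
  assumes "k > 0"
  shows "fps_dilate k f $ n = (if k dvd n then f $ (n div k) else 0)"
proof -
  have "fps_dilate k f $ n = (\<Sum>i\<in>{0..n}. if n = k * i then f $ i else 0)"
    unfolding fps_dilate_def fps_compose_nth power_mult[symmetric] fps_X_power_nth
    by (intro sum.cong) auto
  also have "\<dots> = (if k dvd n then f $ (n div k) else 0)"
  proof (cases "k dvd n")
    case True
    then obtain j where j: "n = k * j" by (elim dvdE)
    have "(\<Sum>i\<in>{0..n}. if n = k * i then f $ i else 0) = (\<Sum>i\<in>{0..n}. if i = j then f $ i else 0)"
      using assms j by (intro sum.cong) auto
    also have "\<dots> = f $ j" using assms j by (simp add: sum.delta)
    finally show ?thesis using assms j by simp
  next
    case False
    then have "\<And>i. n \<noteq> k * i" by auto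
    then show ?thesis using False by simp
  qed
  finally show ?thesis .
qed

lemma fps_dilate_mult: "k > 0 \<Longrightarrow> fps_dilate k (f * g) = fps_dilate k f * fps_dilate k g"
  by (simp add: fps_dilate_def fps_compose_mult_distrib zero_power)

lemma fps_dilate_power: "k > 0 \<Longrightarrow> fps_dilate k (f ^ n) = fps_dilate k f ^ n"
  by (simp add: fps_dilate_def fps_compose_power[symmetric] zero_power)

lemma fps_dilate_add: "fps_dilate k (f + g) = fps_dilate k f + fps_dilate k g"
  by (simp add: fps_dilate_def fps_compose_add_distrib)

lemma fps_dilate_diff: "fps_dilate k (f - g) = fps_dilate k f - fps_dilate k g"
  by (simp add: fps_dilate_def fps_compose_sub_distrib)

lemma fps_dilate_1: "fps_dilate k 1 = 1"
  by (simp add: fps_dilate_def)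

lemma fps_dilate_numeral: "fps_dilate k (numeral n) = numeral n"
  by (simp only: fps_dilate_def numeral_fps_const fps_const_compose)

lemma fps_dilate_X: "k > 0 \<Longrightarrow> fps_dilate k fps_X = fps_X ^ k"
  by (simp add: fps_dilate_def fps_X_fps_compose_startby0 zero_power)

lemma fps_dilate_prod: "k > 0 \<Longrightarrow> fps_dilate k (prod f A) = (\<Prod>i\<in>A. fps_dilate k (f i))"
  by (simp add: fps_dilate_def fps_compose_prod_distrib zero_power)

lemma fps_dilate_dilate:
  "j > 0 \<Longrightarrow> k > 0 \<Longrightarrow> fps_dilate j (fps_dilate k f) = fps_dilate (j * k) f"
proof (rule fps_ext)
  fix n
  assume jk: "j > 0" "k > 0"
  show "fps_dilate j (fps_dilate k f) $ n = fps_dilate (j * k) f $ n"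
  proof (cases "j dvd n")
    case True
    then obtain m where "n = j * m" by (elim dvdE)
    then show ?thesis using jk by (simp add: fps_dilate_nth)
  next
    case False
    then have "\<not> j * k dvd n" using dvd_mult_left by blast
    then show ?thesis using False jk by (simp add: fps_dilate_nth)
  qed
qed

lemmas fps_dilate_simps =
  fps_dilate_mult fps_dilate_power fps_dilate_add fps_dilate_diff fps_dilate_1
  fps_dilate_numeral fps_dilate_X fps_dilate_dilate

lemma tendsto_fps_dilate: "(f \<longlongrightarrow> a) F \<Longrightarrow> ((\<lambda>x. fps_dilate k (f x)) \<longlongrightarrow> fps_dilate k a) F"
  unfolding fps_dilate_def by (rule tendsto_fps_compose)

definition fps_section :: "nat \<Rightarrow> nat \<Rightarrow> int fps \<Rightarrow> int fps" where
  "fps_section k r f = Abs_fps (\<lambda>n. f $ (k * n + r))"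

lemma fps_section_nth [simp]: "fps_section k r f $ n = f $ (k * n + r)"
  by (simp add: fps_section_def)

text \<open>A series in \<open>q^k\<close> moves exponents by multiples of \<open>k\<close> only, so
  it passes through the extraction and comes out with \<open>q\<close> in place of
  \<open>q^k\<close>.\<close>

lemma fps_section_mult_dilate:
  assumes "r < k"
  shows "fps_section k r (f * fps_dilate k g) = fps_section k r f * g"
proof (rule fps_ext)
  fix n
  have k: "k > 0" using assms by simp
  have "(fps_dilate k g * f) $ (k * n + r) =
      (\<Sum>i=0..k*n+r. if k dvd i then g $ (i div k) * f $ (k * n + r - i) else 0)"
    unfolding fps_mult_nth by (intro sum.cong) (auto simp: fps_dilate_nth k)
  also have "\<dots> = (\<Sum>i\<in>{i\<in>{0..k*n+r}. k dvd i}. g $ (i div k) * f $ (k * n + r - i))"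
    by (rule sum.inter_filter [symmetric]) simp
  also have "\<dots> = (\<Sum>j\<in>{0..n}. g $ j * f $ (k * (n - j) + r))"
  proof (rule sum.reindex_bij_witness[of _ "\<lambda>j. k * j" "\<lambda>i. i div k"])
    fix i assume i: "i \<in> {i\<in>{0..k*n+r}. k dvd i}"
    then obtain j where j: "i = k * j" by auto
    \<comment> \<open>Here \<open>r < k\<close> excludes the multiple of \<open>k\<close> that
      follows \<open>k * n\<close>.\<close>
    have "k * j < k * (n + 1)" using i j assms by (simp add: algebra_simps)
    then have jn: "j \<le> n" using k by (simp only: mult_less_cancel1) simp
    show "k * (i div k) = i" "i div k \<in> {0..n}" using j jn k by auto
    have "k * (n - j) + r = k * n + r - i"
      using mult_le_mono2[OF jn, of k] unfolding j diff_mult_distrib2 by linarith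
    then show "g $ (i div k) * f $ (k * (n - i div k) + r) = g $ (i div k) * f $ (k * n + r - i)"
      using k by (simp add: j)
  next
    fix j assume j: "j \<in> {0..n}"
    show "k * j div k = j" using k by simp
    show "k * j \<in> {i\<in>{0..k*n+r}. k dvd i}" using j by (auto intro: trans_le_add1)
  qed
  also have "\<dots> = (g * fps_section k r f) $ n" by (simp add: fps_mult_nth)
  finally show "fps_section k r (f * fps_dilate k g) $ n = (fps_section k r f * g) $ n"
    by (simp add: mult.commute)
qed

text \<open>The pattern of all 2-dissections below: a quotient whose denominator is a series in
  \<open>q^2\<close> is split by splitting its numerator.\<close>

lemma fps_section_2_unique:
  assumes "f * fps_dilate 2 g = fps_dilate 2 a + fps_X * fps_dilate 2 b"
  shows "fps_section 2 0 f * g = a" "fps_section 2 1 f * g = b"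
proof -
  have "fps_section 2 0 (f * fps_dilate 2 g) = a" "fps_section 2 1 (f * fps_dilate 2 g) = b"
    unfolding assms by (auto simp: fps_eq_iff fps_dilate_nth)
  then show "fps_section 2 0 f * g = a" "fps_section 2 1 f * g = b"
    by (simp_all add: fps_section_mult_dilate)
qed

section \<open>The Jacobi triple product\<close>

lemma fps_right_inverse_1:
  fixes f :: "'a::comm_ring_1 fps"
  shows "f $ 0 = 1 \<Longrightarrow> f * fps_right_inverse f 1 = 1"
  by (rule fps_right_inverse) simp

lemma sum_int_symmetric:
  fixes g :: "int \<Rightarrow> 'a::comm_monoid_add"
  shows "(\<Sum>n\<in>{- int N..int N}. g n) = g 0 + (\<Sum>n<N. g (int (Suc n)) + g (- int (Suc n)))"
proof (induction N)
  case (Suc N)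
  have "{- int (Suc N)..int (Suc N)} = insert (int (Suc N)) (insert (- int (Suc N)) {- int N..int N})"
    by auto
  then show ?case by (simp add: Suc ac_simps del: of_nat_Suc)
qed simp

section \<open>Gaussian binomial coefficients\<close>

definition qfac :: "'a::comm_ring_1 fps \<Rightarrow> nat \<Rightarrow> 'a fps" where
  "qfac Q n = (\<Prod>i<n. 1 - Q ^ Suc i)"

lemma qfac_0 [simp]: "qfac Q 0 = 1"
  by (simp add: qfac_def)

lemma qfac_Suc: "qfac Q (Suc n) = qfac Q n * (1 - Q ^ Suc n)"
  by (simp add: qfac_def)

lemma qfac_nth_0 [simp]: "Q $ 0 = 0 \<Longrightarrow> qfac Q n $ 0 = 1"
  by (induction n) (simp_all add: qfac_Suc)

lemma qfac_diff_dvd: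
  assumes "m \<le> n"
  shows "Q ^ Suc m dvd qfac Q n - qfac Q m"
  using assms
proof (induction n rule: dec_induct)
  case (step n)
  have "qfac Q (Suc n) - qfac Q m = (qfac Q n - qfac Q m) - qfac Q n * Q ^ Suc n"
    by (simp add: qfac_Suc algebra_simps)
  moreover have "Q ^ Suc m dvd Q ^ Suc n" using step by (intro le_imp_power_dvd) simp
  ultimately show ?case using step by (metis dvd_diff dvd_mult)
qed simp

text \<open>The value 0 at negative \<open>k\<close> is the usual convention for
  \<open>1/(Q;Q)_k\<close>; with it the recurrences below need no boundary cases.\<close>

definition qfac_inv :: "'a::comm_ring_1 fps \<Rightarrow> int \<Rightarrow> 'a fps" where
  "qfac_inv Q k = (if k < 0 then 0 else fps_right_inverse (qfac Q (nat k)) 1)"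

lemma qfac_inv_neg: "k < 0 \<Longrightarrow> qfac_inv Q k = 0"
  by (simp add: qfac_inv_def)

lemma qfac_mult_inv: "Q $ 0 = 0 \<Longrightarrow> qfac Q n * qfac_inv Q (int n) = 1"
  by (simp add: qfac_inv_def fps_right_inverse_1)

text \<open>At \<open>n = 0\<close> both sides vanish, the right one by its factor
  \<open>1 - Q^0\<close>.\<close>

lemma qfac_inv_pred:
  assumes "Q $ 0 = 0"
  shows "qfac_inv Q (int n - 1) = (1 - Q ^ n) * qfac_inv Q (int n)"
proof (cases n)
  case 0
  then show ?thesis by (simp add: qfac_inv_neg)
next
  case (Suc m)
  have "(1 - Q ^ Suc m) * qfac_inv Q (int (Suc m)) =
      (qfac Q m * qfac_inv Q (int m)) * (1 - Q ^ Suc m) * qfac_inv Q (int (Suc m))"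
    by (simp add: qfac_mult_inv assms)
  also have "\<dots> = qfac_inv Q (int m) * (qfac Q (Suc m) * qfac_inv Q (int (Suc m)))"
    by (simp add: qfac_Suc mult_ac)
  also have "\<dots> = qfac_inv Q (int m)"
    by (simp only: qfac_mult_inv assms mult_1_right)
  finally show ?thesis using Suc by simp
qed

lemma qfac_inv_pred2:
  assumes "Q $ 0 = 0"
  shows "qfac_inv Q (int n - 2) = (1 - Q ^ n) * (1 - Q ^ (n - 1)) * qfac_inv Q (int n)"
proof (cases n)
  case 0
  then show ?thesis by (simp add: qfac_inv_neg)
next
  case (Suc m)
  have "qfac_inv Q (int n - 2) = qfac_inv Q (int m - 1)" using Suc by simp
  also have "\<dots> = (1 - Q ^ m) * qfac_inv Q (int n - 1)"
    unfolding qfac_inv_pred[OF assms, of m] using Suc by simp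
  also have "\<dots> = (1 - Q ^ n) * (1 - Q ^ (n - 1)) * qfac_inv Q (int n)"
    unfolding qfac_inv_pred[OF assms, of n] using Suc by (simp add: mult_ac)
  finally show ?thesis .
qed

text \<open>The Gaussian binomial coefficient \<open>2N\<close> over \<open>N + n\<close>, which is \<open>0\<close> for \<open>\<bar>n\<bar> > N\<close>.\<close>

definition central_gauss :: "'a::comm_ring_1 fps \<Rightarrow> nat \<Rightarrow> int \<Rightarrow> 'a fps" where
  "central_gauss Q N n = qfac Q (2 * N) * qfac_inv Q (int N + n) * qfac_inv Q (int N - n)"

lemma central_gauss_outside: "\<bar>n\<bar> > int N \<Longrightarrow> central_gauss Q N n = 0"
  unfolding central_gauss_def by (cases "n > 0") (auto simp: qfac_inv_neg)

text \<open>The q-Pascal rule applied twice. Written with \<open>p\<close> and \<open>r\<close>, all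
  terms are multiples of \<open>qfac_inv Q (int p) * qfac_inv Q (int r)\<close>, which leaves the
  polynomial identity \<open>key\<close>.\<close>

lemma central_gauss_Suc:
  assumes "Q $ 0 = 0" "\<bar>n\<bar> \<le> int (Suc N)"
  shows "central_gauss Q (Suc N) n = (1 + Q ^ (2 * N + 1)) * central_gauss Q N n
    + Q ^ nat (int N - n + 1) * central_gauss Q N (n - 1)
    + Q ^ nat (int N + n + 1) * central_gauss Q N (n + 1)"
proof -
  define p r where "p = nat (int N + n + 1)" and "r = nat (int N - n + 1)"
  have p: "int N + n + 1 = int p" and r: "int N - n + 1 = int r" and pr: "p + r = 2 * N + 2"
    using assms(2) by (auto simp: p_def r_def)
  have args: "int N + n = int p - 1" "int N - n = int r - 1" "int N + (n - 1) = int p - 2"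
    "int N - (n - 1) = int r" "int N + (n + 1) = int p" "int N - (n + 1) = int r - 2"
    "int (Suc N) + n = int p" "int (Suc N) - n = int r"
    using p r by auto
  have key: "(1 - Q ^ (2 * N + 1)) * (1 - Q ^ (2 * N + 2)) =
      (1 + Q ^ (2 * N + 1)) * (1 - Q ^ p) * (1 - Q ^ r)
      + Q ^ r * (1 - Q ^ p) * (1 - Q ^ (p - 1)) + Q ^ p * (1 - Q ^ r) * (1 - Q ^ (r - 1))"
  \<comment> \<open>The truncated differences \<open>p - 1\<close> and \<open>r - 1\<close> force
    this split.\<close>
  proof (cases "p = 0 \<or> r = 0")
    case True
    then show ?thesis using pr by auto
  next
    case False
    then obtain a b where ab: "p = Suc a" "r = Suc b" by (metis not0_implies_Suc)
    then have N: "2 * N = a + b" using pr by simp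
    show ?thesis unfolding ab N by (simp add: power_add algebra_simps)
  qed
  have q: "qfac Q (2 * Suc N) = qfac Q (2 * N) * ((1 - Q ^ (2 * N + 1)) * (1 - Q ^ (2 * N + 2)))"
    by (simp add: qfac_Suc mult.assoc)
  show ?thesis
    unfolding central_gauss_def p r nat_int args qfac_inv_pred[OF assms(1)]
      qfac_inv_pred2[OF assms(1)] q key
    by (simp add: algebra_simps)
qed

text \<open>For \<open>x * y = Q\<close> this is \<open>x^n Q^(n(n-1)/2)\<close> at every integer
  \<open>n\<close>. The second parameter stands for \<open>Q/x\<close>, so that \<open>x\<close>
  need not be invertible.\<close>

definition jacobi_term :: "'a::comm_ring_1 \<Rightarrow> 'a \<Rightarrow> 'a \<Rightarrow> int \<Rightarrow> 'a" where
  "jacobi_term Q x y n = (if n \<ge> 0 then x ^ nat n * Q ^ (nat n choose 2)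
     else y ^ nat (- n) * Q ^ (nat (- n) choose 2))"

lemma jacobi_term_of_nat: "jacobi_term Q x y (int n) = x ^ n * Q ^ (n choose 2)"
  by (simp add: jacobi_term_def)

lemma jacobi_term_neg_of_nat: "jacobi_term Q x y (- int n) = y ^ n * Q ^ (n choose 2)"
  by (cases n) (simp_all add: jacobi_term_def nat_add_distrib)

text \<open>Multiplication by \<open>x\<close> shifts the index and costs \<open>Q^(-n)\<close>; the
  factor \<open>Q^N\<close> keeps the exponent nonnegative.\<close>

lemma jacobi_term_mult_left:
  assumes "x * y = Q" "\<bar>n\<bar> \<le> int N"
  shows "Q ^ N * x * jacobi_term Q x y n = Q ^ nat (int N - n) * jacobi_term Q x y (n + 1)"
proof (cases "n \<ge> 0")
  case True
  then obtain m where m: "n = int m" using nonneg_eq_int by blast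
  then have mN: "m \<le> N" using assms by simp
  have c: "Suc m choose 2 = (m choose 2) + m" by (simp add: numeral_2_eq_2)
  have e: "Q ^ N = Q ^ (N - m) * Q ^ m" using mN by (simp flip: power_add)
  have "nat (int N - n) = N - m" "n + 1 = int (Suc m)" using m mN by auto
  then show ?thesis unfolding m jacobi_term_of_nat c e
    by (simp only: jacobi_term_of_nat) (simp add: c power_add mult_ac)
next
  case False
  then obtain m where m: "n = - int (Suc m)"
    by (metis add.inverse_inverse int_cases negative_zle not_le of_nat_0_le_iff)
  have c: "Suc m choose 2 = (m choose 2) + m" by (simp add: numeral_2_eq_2)
  have e: "nat (int N - n) = N + Suc m" "n + 1 = - int m" using m by auto
  have "Q ^ N * x * jacobi_term Q x y n = Q ^ N * (x * y) * y ^ m * Q ^ (m choose 2) * Q ^ m"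
    unfolding m jacobi_term_neg_of_nat c by (simp add: power_add mult_ac)
  also have "\<dots> = Q ^ nat (int N - n) * jacobi_term Q x y (n + 1)"
    unfolding assms(1) e jacobi_term_neg_of_nat by (simp add: power_add mult_ac)
  finally show ?thesis .
qed

lemma jacobi_term_uminus: "jacobi_term Q x y (- n) = jacobi_term Q y x n"
  by (auto simp: jacobi_term_def)

lemma jacobi_term_mult_right:
  assumes "x * y = Q" "\<bar>n\<bar> \<le> int N"
  shows "Q ^ N * y * jacobi_term Q x y n = Q ^ nat (int N + n) * jacobi_term Q x y (n - 1)"
  using jacobi_term_mult_left[of y x Q "- n" N] assms jacobi_term_uminus[of Q y x n]
    jacobi_term_uminus[of Q y x "n - 1"]
  by (simp add: mult.commute[of y x])

text \<open>Induction on \<open>N\<close>. The two new factors multiply to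
  \<open>1 + Q^(2N+1) + Q^N x + Q^N y\<close>; the last two summands shift the index by 1 and -1,
  and \<open>central_gauss_Suc\<close> collects the three sums.\<close>

lemma finite_jacobi_triple_product:
  assumes "Q $ 0 = 0" "x * y = Q"
  shows "(\<Prod>i<N. (1 + x * Q ^ i) * (1 + y * Q ^ i)) =
    (\<Sum>n\<in>{- int N..int N}. central_gauss Q N n * jacobi_term Q x y n)"
proof (induction N)
  case 0
  then show ?case
    using qfac_mult_inv[OF assms(1), of 0] by (simp add: central_gauss_def jacobi_term_def numeral_2_eq_2)
next
  case (Suc N)
  let ?c = "central_gauss Q N" and ?t = "jacobi_term Q x y"
  let ?I = "{- int N..int N}" and ?J = "{- int (Suc N)..int (Suc N)}"
  have "(\<Prod>i<Suc N. (1 + x * Q ^ i) * (1 + y * Q ^ i)) =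
      (\<Sum>n\<in>?I. ?c n * ?t n) * ((1 + x * Q ^ N) * (1 + y * Q ^ N))"
    by (simp add: Suc)
  also have "(1 + x * Q ^ N) * (1 + y * Q ^ N) = 1 + (x * y) * Q ^ (2 * N) + Q ^ N * x + Q ^ N * y"
    by (simp add: algebra_simps power_mult power2_eq_square)
  also have "x * y * Q ^ (2 * N) = Q ^ (2 * N + 1)" by (simp add: assms(2))
  also have "(\<Sum>n\<in>?I. ?c n * ?t n) * (1 + Q ^ (2 * N + 1) + Q ^ N * x + Q ^ N * y) =
      (\<Sum>n\<in>?I. (1 + Q ^ (2 * N + 1)) * ?c n * ?t n) + (\<Sum>n\<in>?I. ?c n * (Q ^ N * x * ?t n))
      + (\<Sum>n\<in>?I. ?c n * (Q ^ N * y * ?t n))"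
    unfolding sum_distrib_right sum.distrib[symmetric]
    by (intro sum.cong) (simp_all add: algebra_simps)
  \<comment> \<open>All three sums are brought to the range \<open>?J\<close>; the added terms are 0
    because \<open>central_gauss Q N\<close> vanishes beyond \<open>N\<close>.\<close>
  also have "(\<Sum>n\<in>?I. (1 + Q ^ (2 * N + 1)) * ?c n * ?t n) =
      (\<Sum>n\<in>?J. (1 + Q ^ (2 * N + 1)) * ?c n * ?t n)"
    by (intro sum.mono_neutral_left) (auto simp: central_gauss_outside)
  also have "(\<Sum>n\<in>?I. ?c n * (Q ^ N * x * ?t n)) =
      (\<Sum>n\<in>?I. Q ^ nat (int N - n) * ?c n * ?t (n + 1))"
    by (intro sum.cong refl, subst jacobi_term_mult_left[OF assms(2)]) (auto simp: mult_ac)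
  also have "\<dots> = (\<Sum>n\<in>{- int N + 1..int N + 1}. Q ^ nat (int N - n + 1) * ?c (n - 1) * ?t n)"
    by (rule sum.reindex_bij_witness[of _ "\<lambda>n. n - 1" "\<lambda>n. n + 1"]) auto
  also have "\<dots> = (\<Sum>n\<in>?J. Q ^ nat (int N - n + 1) * ?c (n - 1) * ?t n)"
    by (intro sum.mono_neutral_left) (auto simp: central_gauss_outside)
  also have "(\<Sum>n\<in>?I. ?c n * (Q ^ N * y * ?t n)) =
      (\<Sum>n\<in>?I. Q ^ nat (int N + n) * ?c n * ?t (n - 1))"
    by (intro sum.cong refl, subst jacobi_term_mult_right[OF assms(2)]) (auto simp: mult_ac)
  also have "\<dots> = (\<Sum>n\<in>{- int N - 1..int N - 1}. Q ^ nat (int N + n + 1) * ?c (n + 1) * ?t n)"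
    by (rule sum.reindex_bij_witness[of _ "\<lambda>n. n + 1" "\<lambda>n. n - 1"]) (auto simp: add.assoc)
  also have "\<dots> = (\<Sum>n\<in>?J. Q ^ nat (int N + n + 1) * ?c (n + 1) * ?t n)"
    by (intro sum.mono_neutral_left) (auto simp: central_gauss_outside)
  also have "(\<Sum>n\<in>?J. (1 + Q ^ (2 * N + 1)) * ?c n * ?t n)
      + (\<Sum>n\<in>?J. Q ^ nat (int N - n + 1) * ?c (n - 1) * ?t n)
      + (\<Sum>n\<in>?J. Q ^ nat (int N + n + 1) * ?c (n + 1) * ?t n) =
      (\<Sum>n\<in>?J. central_gauss Q (Suc N) n * ?t n)"
    unfolding sum.distrib[symmetric]
    by (intro sum.cong refl, subst central_gauss_Suc[OF assms(1)]) (auto simp: algebra_simps)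
  finally show ?case .
qed

text \<open>With \<open>m = |n|\<close>, the factor \<open>central_gauss Q N n * qfac Q N\<close> is
  1 up to order \<open>N - m + 1\<close> in \<open>Q\<close>, and the theta term contributes order
  \<open>m choose 2\<close>. Together this is at least \<open>N\<close>.\<close>

lemma jacobi_triple_product_approx:
  assumes "Q $ 0 = 0" "x * y = Q"
  shows "Q ^ N dvd (\<Prod>i<N. (1 + x * Q ^ i) * (1 + y * Q ^ i)) * qfac Q N -
    (\<Sum>n\<in>{- int N..int N}. jacobi_term Q x y n)"
proof -
  have "Q ^ N dvd (central_gauss Q N n * qfac Q N - 1) * jacobi_term Q x y n"
    if n: "n \<in> {- int N..int N}" for n
  proof -
    define m where "m = nat \<bar>n\<bar>"
    have m: "m \<le> N" using n by (auto simp: m_def)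
    have "central_gauss Q N n =
        qfac Q (2 * N) * (qfac_inv Q (int (N + m)) * qfac_inv Q (int (N - m)))"
      using m by (cases "n \<ge> 0") (auto simp: central_gauss_def m_def of_nat_diff mult_ac)
    then have "central_gauss Q N n * qfac Q N - 1 =
        qfac_inv Q (int (N + m)) * qfac_inv Q (int (N - m)) * (qfac Q (2 * N) * qfac Q N) - 1 * 1"
      by (simp only: mult_ac mult_1_right)
    \<comment> \<open>Each 1 is written as a q-factorial times its inverse, so that only differences
      of q-factorials remain.\<close>
    also have "\<dots> = qfac_inv Q (int (N + m)) * qfac_inv Q (int (N - m)) * (qfac Q (2 * N) * qfac Q N)
        - (qfac Q (N + m) * qfac_inv Q (int (N + m))) * (qfac Q (N - m) * qfac_inv Q (int (N - m)))"
      by (simp only: qfac_mult_inv assms(1))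
    also have "\<dots> = qfac_inv Q (int (N + m)) * qfac_inv Q (int (N - m)) *
        ((qfac Q (2 * N) - qfac Q (N + m)) * qfac Q N + qfac Q (N + m) * (qfac Q N - qfac Q (N - m)))"
      by (simp add: algebra_simps)
    finally have 1: "central_gauss Q N n * qfac Q N - 1 = \<dots>" .
    have "Q ^ Suc (N + m) dvd qfac Q (2 * N) - qfac Q (N + m)"
      "Q ^ Suc (N - m) dvd qfac Q N - qfac Q (N - m)"
      using m by (simp_all add: qfac_diff_dvd del: power_Suc)
    moreover have "Q ^ Suc (N - m) dvd Q ^ Suc (N + m)" by (rule le_imp_power_dvd) simp
    ultimately have 2: "Q ^ Suc (N - m) dvd central_gauss Q N n * qfac Q N - 1"
      unfolding 1 by (meson dvd_add dvd_mult dvd_mult2 dvd_trans)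
    have 3: "Q ^ (m choose 2) dvd jacobi_term Q x y n"
      by (auto simp: jacobi_term_def m_def)
    have "m \<le> Suc (m choose 2)"
      by (induction m) (auto simp: numeral_2_eq_2)
    then have "Q ^ N dvd Q ^ (Suc (N - m) + (m choose 2))"
      using m by (intro le_imp_power_dvd) simp
    also have "\<dots> dvd (central_gauss Q N n * qfac Q N - 1) * jacobi_term Q x y n"
      unfolding power_add using 2 3 by (rule mult_dvd_mono)
    finally show ?thesis .
  qed
  then have "Q ^ N dvd (\<Sum>n\<in>{- int N..int N}. (central_gauss Q N n * qfac Q N - 1) * jacobi_term Q x y n)"
    by (rule dvd_sum)
  then show ?thesis unfolding finite_jacobi_triple_product[OF assms] sum_distrib_right
    by (simp add: algebra_simps sum_subtractf)
qed

text \<open>Here \<open>s\<close> is the bilateral sum without its central term, the indices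
  \<open>n\<close> and \<open>-n\<close> being paired. As \<open>Q\<close> has no constant term, an
  error divisible by \<open>Q^N\<close> tends to 0.\<close>

theorem jacobi_triple_product:
  assumes "Q $ 0 = 0" "x * y = Q"
    and "(\<lambda>N. \<Sum>n<N. (x ^ Suc n + y ^ Suc n) * Q ^ (Suc n choose 2)) \<longlonglongrightarrow> s"
  shows "(\<lambda>N. (\<Prod>i<N. (1 + x * Q ^ i) * (1 + y * Q ^ i)) * qfac Q N) \<longlonglongrightarrow> 1 + s"
proof (rule tendsto_fps_close)
  show "(\<lambda>N. 1 + (\<Sum>n<N. (x ^ Suc n + y ^ Suc n) * Q ^ (Suc n choose 2))) \<longlonglongrightarrow> 1 + s"
    by (rule tendsto_fps_add[OF tendsto_const assms(3)])
  fix N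
  have eq: "1 + (\<Sum>n<N. (x ^ Suc n + y ^ Suc n) * Q ^ (Suc n choose 2)) =
      (\<Sum>n\<in>{- int N..int N}. jacobi_term Q x y n)"
    unfolding sum_int_symmetric
    by (simp add: jacobi_term_def nat_add_distrib algebra_simps numeral_2_eq_2 del: power_Suc)
  have dvd: "fps_X ^ N dvd Q ^ N"
    using assms(1) fps_X_power_dvd_iff[of 1 Q] by (intro dvd_power_same) simp
  show "fps_X ^ N dvd (\<Prod>i<N. (1 + x * Q ^ i) * (1 + y * Q ^ i)) * qfac Q N -
      (1 + (\<Sum>n<N. (x ^ Suc n + y ^ Suc n) * Q ^ (Suc n choose 2)))"
    unfolding eq by (rule dvd_trans[OF dvd jacobi_triple_product_approx[OF assms(1,2)]])
qed

section \<open>Theta series and Euler products\<close>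

definition fps_of_set :: "nat set \<Rightarrow> int fps" where
  "fps_of_set A = Abs_fps (\<lambda>n. if n \<in> A then 1 else 0)"

text \<open>Strict monotonicity gives \<open>e n \<ge> n\<close>, so exponent \<open>m\<close> is
  decided by the first \<open>m + 1\<close> summands and occurs at most once.\<close>

lemma tendsto_fps_of_set:
  assumes "strict_mono e"
  shows "(\<lambda>N. \<Sum>n<N. fps_X ^ e n) \<longlonglongrightarrow> fps_of_set (range e)"
proof (rule tendsto_fpsI)
  fix m
  have "fps_nth (\<Sum>n<N. fps_X ^ e n) m = fps_of_set (range e) $ m" if "N > m" for N
  proof (cases "m \<in> range e")
    case True
    then obtain k where k: "m = e k" by auto
    then have "k < N" using seq_suble[OF assms, of k] that by simp
    have "fps_nth (\<Sum>n<N. fps_X ^ e n) m = (\<Sum>n<N. if n = k then 1 else 0 :: int)"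
      unfolding fps_sum_nth using assms k
      by (intro sum.cong) (auto simp: fps_X_power_nth strict_mono_eq)
    then show ?thesis using True \<open>k < N\<close> by (simp add: fps_of_set_def)
  next
    case False
    then have "\<And>n. m \<noteq> e n" by auto
    with False show ?thesis by (simp add: fps_of_set_def fps_sum_nth fps_X_power_nth)
  qed
  then show "\<forall>\<^sub>F N in sequentially. (\<Sum>n<N. fps_X ^ e n) $ m = fps_of_set (range e) $ m"
    by (rule eventually_mono[OF eventually_gt_at_top[of m]])
qed

definition phi :: "int fps" where
  "phi = 1 + 2 * fps_of_set (range (\<lambda>n. (Suc n) ^ 2))"

definition psi :: "int fps" where
  "psi = fps_of_set (range (\<lambda>n. Suc n choose 2))"

lemma phi_nth: "phi $ n = (if n = 0 then 1 else if \<exists>k. n = k ^ 2 then 2 else 0)"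
proof -
  have "n \<in> range (\<lambda>n. (Suc n) ^ 2) \<longleftrightarrow> n \<noteq> 0 \<and> (\<exists>k. n = k ^ 2)"
  proof
    assume "n \<noteq> 0 \<and> (\<exists>k. n = k ^ 2)"
    then obtain k j where "n = k ^ 2" "k = Suc j" by (metis not0_implies_Suc zero_power2)
    then show "n \<in> range (\<lambda>n. (Suc n) ^ 2)" by blast
  qed auto
  moreover have "(2 * f) $ n = 2 * f $ n" for f :: "int fps"
    by (simp only: mult_2 fps_add_nth)
  ultimately show ?thesis
    by (simp only: phi_def fps_of_set_def fps_add_nth fps_one_nth fps_nth_Abs_fps) simp
qed

lemma psi_nth: "psi $ n = (if \<exists>k. n = Suc k choose 2 then 1 else 0)"
  by (auto simp: psi_def fps_of_set_def)

text \<open>In q-Pochhammer notation this is \<open>(q;q)_inf\<close>; the next three products are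
  \<open>(-q;q)_inf\<close>, \<open>(q;q^2)_inf\<close> and \<open>(-q;q^2)_inf\<close>.\<close>

definition euler_fps :: "int fps" where
  "euler_fps = fps_inf_prod (\<lambda>i. 1 - fps_X ^ Suc i)"

definition distinct_fps :: "int fps" where
  "distinct_fps = fps_inf_prod (\<lambda>i. 1 + fps_X ^ Suc i)"

definition odd_euler_fps :: "int fps" where
  "odd_euler_fps = fps_inf_prod (\<lambda>i. 1 - fps_X ^ Suc (2 * i))"

definition odd_distinct_fps :: "int fps" where
  "odd_distinct_fps = fps_inf_prod (\<lambda>i. 1 + fps_X ^ Suc (2 * i))"

lemma tendsto_qfac: "qfac fps_X \<longlonglongrightarrow> euler_fps"
  unfolding euler_fps_def qfac_def by (rule tendsto_fps_inf_prod) (simp del: power_Suc)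

lemma tendsto_distinct_fps: "(\<lambda>N. \<Prod>i<N. 1 + fps_X ^ Suc i) \<longlonglongrightarrow> distinct_fps"
  unfolding distinct_fps_def by (rule tendsto_fps_inf_prod) (simp del: power_Suc)

lemma tendsto_odd_euler_fps: "(\<lambda>N. \<Prod>i<N. 1 - fps_X ^ Suc (2 * i)) \<longlonglongrightarrow> odd_euler_fps"
  unfolding odd_euler_fps_def
  by (rule tendsto_fps_inf_prod) (simp add: le_imp_power_dvd del: power_Suc)

lemma tendsto_odd_distinct_fps: "(\<lambda>N. \<Prod>i<N. 1 + fps_X ^ Suc (2 * i)) \<longlonglongrightarrow> odd_distinct_fps"
  unfolding odd_distinct_fps_def
  by (rule tendsto_fps_inf_prod) (simp add: le_imp_power_dvd del: power_Suc)

lemma fps_dilate_qfac: "k > 0 \<Longrightarrow> fps_dilate k (qfac Q n) = qfac (fps_dilate k Q) n"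
  by (simp only: qfac_def fps_dilate_prod fps_dilate_simps)

lemma tendsto_qfac_X_power: "k > 0 \<Longrightarrow> qfac (fps_X ^ k) \<longlonglongrightarrow> fps_dilate k euler_fps"
  using tendsto_fps_dilate[OF tendsto_qfac, of k] by (simp add: fps_dilate_qfac fps_dilate_X)

lemma one_plus_mult_one_minus: "(1 + y) * (1 - y) = 1 - y ^ 2" for y :: "'a::comm_ring_1"
  by (simp add: algebra_simps power2_eq_square)

section \<open>Relations between the products, and product formulas for the theta series\<close>

lemma distinct_mult_euler: "distinct_fps * euler_fps = fps_dilate 2 euler_fps"
proof (rule LIMSEQ_unique)
  show "(\<lambda>N. (\<Prod>i<N. 1 + fps_X ^ Suc i) * qfac fps_X N) \<longlonglongrightarrow> distinct_fps * euler_fps"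
    by (intro tendsto_fps_mult tendsto_distinct_fps tendsto_qfac)
  have "(\<Prod>i<N. 1 + fps_X ^ Suc i) * qfac fps_X N = (qfac (fps_X ^ 2) N :: int fps)" for N
    unfolding qfac_def prod.distrib[symmetric] one_plus_mult_one_minus power_mult[symmetric]
    by (simp only: mult.commute)
  then show "(\<lambda>N. (\<Prod>i<N. 1 + fps_X ^ Suc i) * qfac fps_X N) \<longlonglongrightarrow> fps_dilate 2 euler_fps"
    by (simp only: tendsto_qfac_X_power zero_less_numeral)
qed

text \<open>The factors are sorted by parity of the exponent. This is exact at finite level:
  \<open>N\<close> odd and \<open>N\<close> even factors make up the first
  \<open>2 * N\<close>.\<close>

lemma odd_euler_mult: "odd_euler_fps * fps_dilate 2 euler_fps = euler_fps"
proof (rule LIMSEQ_unique)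
  show "(\<lambda>N. (\<Prod>i<N. 1 - fps_X ^ Suc (2 * i)) * qfac (fps_X ^ 2) N) \<longlonglongrightarrow>
      odd_euler_fps * fps_dilate 2 euler_fps"
    by (intro tendsto_fps_mult tendsto_odd_euler_fps tendsto_qfac_X_power) simp
  have "(\<Prod>i<N. 1 - fps_X ^ Suc (2 * i)) * qfac (fps_X ^ 2) N = (qfac fps_X (2 * N) :: int fps)" for N
  proof (induction N)
    case (Suc N)
    have "qfac fps_X (2 * Suc N) =
        (qfac fps_X (2 * N) * (1 - fps_X ^ Suc (2 * N)) * (1 - fps_X ^ Suc (Suc (2 * N))) :: int fps)"
      by (simp add: qfac_Suc del: power_Suc)
    moreover have "(fps_X ^ 2) ^ Suc N = (fps_X ^ Suc (Suc (2 * N)) :: int fps)"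
      by (simp only: power_mult[symmetric] mult_Suc_right add_2_eq_Suc)
    ultimately show ?case unfolding Suc[symmetric] prod.lessThan_Suc qfac_Suc
      by (simp only: mult_ac)
  qed simp
  then show "(\<lambda>N. (\<Prod>i<N. 1 - fps_X ^ Suc (2 * i)) * qfac (fps_X ^ 2) N) \<longlonglongrightarrow> euler_fps"
    using filterlim_subseq_mult[OF tendsto_qfac, of 2] by simp
qed

lemma odd_distinct_mult: "odd_distinct_fps * fps_dilate 2 distinct_fps = distinct_fps"
proof (rule LIMSEQ_unique)
  show "(\<lambda>N. (\<Prod>i<N. 1 + fps_X ^ Suc (2 * i)) * fps_dilate 2 (\<Prod>i<N. 1 + fps_X ^ Suc i)) \<longlonglongrightarrow>
      odd_distinct_fps * fps_dilate 2 distinct_fps"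
    by (intro tendsto_fps_mult tendsto_odd_distinct_fps tendsto_fps_dilate tendsto_distinct_fps)
  have "(\<Prod>i<N. 1 + fps_X ^ Suc (2 * i)) * fps_dilate 2 (\<Prod>i<N. 1 + fps_X ^ Suc i) =
      (\<Prod>i<2 * N. 1 + fps_X ^ Suc i)" for N
  proof (induction N)
    case (Suc N)
    have "fps_dilate 2 (fps_X ^ Suc N) = fps_X ^ Suc (Suc (2 * N))"
      by (simp add: fps_dilate_simps flip: power_mult del: power_Suc)
    then show ?case unfolding prod.lessThan_Suc mult_Suc_right add_2_eq_Suc Suc[symmetric]
      by (simp add: fps_dilate_simps mult_ac del: power_Suc)
  qed (simp add: fps_dilate_1)
  then show "(\<lambda>N. (\<Prod>i<N. 1 + fps_X ^ Suc (2 * i)) * fps_dilate 2 (\<Prod>i<N. 1 + fps_X ^ Suc i))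
      \<longlonglongrightarrow> distinct_fps"
    using filterlim_subseq_mult[OF tendsto_distinct_fps, of 2] by simp
qed

lemma odd_distinct_mult_odd_euler: "odd_distinct_fps * odd_euler_fps = fps_dilate 2 odd_euler_fps"
proof (rule LIMSEQ_unique)
  show "(\<lambda>N. (\<Prod>i<N. 1 + fps_X ^ Suc (2 * i)) * (\<Prod>i<N. 1 - fps_X ^ Suc (2 * i))) \<longlonglongrightarrow>
      odd_distinct_fps * odd_euler_fps"
    by (intro tendsto_fps_mult tendsto_odd_distinct_fps tendsto_odd_euler_fps)
  have "(\<Prod>i<N. 1 + fps_X ^ Suc (2 * i)) * (\<Prod>i<N. 1 - fps_X ^ Suc (2 * i)) =
      fps_dilate 2 (\<Prod>i<N. 1 - fps_X ^ Suc (2 * i))" for N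
    unfolding prod.distrib[symmetric] one_plus_mult_one_minus fps_dilate_prod[OF zero_less_numeral]
    by (simp only: fps_dilate_simps zero_less_numeral power_mult[symmetric] mult.commute)
  then show "(\<lambda>N. (\<Prod>i<N. 1 + fps_X ^ Suc (2 * i)) * (\<Prod>i<N. 1 - fps_X ^ Suc (2 * i))) \<longlonglongrightarrow>
      fps_dilate 2 odd_euler_fps"
    by (simp only: tendsto_fps_dilate tendsto_odd_euler_fps)
qed

text \<open>The triple product with \<open>Q = q^2\<close> and \<open>x = y = q\<close>.\<close>

lemma phi_eq: "phi = odd_distinct_fps ^ 2 * fps_dilate 2 euler_fps"
proof (rule LIMSEQ_unique)
  have eq: "(fps_X ^ Suc n + fps_X ^ Suc n) * (fps_X ^ 2) ^ (Suc n choose 2) =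
      2 * (fps_X ^ (Suc n) ^ 2 :: int fps)" for n
  proof -
    have "Suc n + 2 * (Suc n choose 2) = (Suc n) ^ 2"
      by (simp add: choose_two power2_eq_square)
    then show ?thesis by (simp flip: power_mult power_add mult_2 del: power_Suc)
  qed
  have "strict_mono (\<lambda>n. (Suc n) ^ 2)" by (simp add: strict_mono_def power_strict_mono)
  from tendsto_fps_mult[OF tendsto_const tendsto_fps_of_set[OF this], of 2]
  have "(\<lambda>N. \<Sum>n<N. (fps_X ^ Suc n + fps_X ^ Suc n) * (fps_X ^ 2) ^ (Suc n choose 2)) \<longlonglongrightarrow>
      2 * fps_of_set (range (\<lambda>n. (Suc n) ^ 2))"
    unfolding eq by (simp only: sum_distrib_left)
  then show "(\<lambda>N. (\<Prod>i<N. (1 + fps_X * (fps_X ^ 2) ^ i) * (1 + fps_X * (fps_X ^ 2) ^ i)) * qfac (fps_X ^ 2) N)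
      \<longlonglongrightarrow> phi"
    unfolding phi_def by (intro jacobi_triple_product) (simp_all add: power2_eq_square)
  have "fps_X * (fps_X ^ 2) ^ i = (fps_X ^ Suc (2 * i) :: int fps)" for i
    by (simp flip: power_mult)
  then have "(\<Prod>i<N. (1 + fps_X * (fps_X ^ 2) ^ i) * (1 + fps_X * (fps_X ^ 2) ^ i)) =
      (\<Prod>i<N. 1 + fps_X ^ Suc (2 * i) :: int fps) ^ 2" for N
    by (simp only: prod.distrib power2_eq_square[of "prod _ _"])
  then show "(\<lambda>N. (\<Prod>i<N. (1 + fps_X * (fps_X ^ 2) ^ i) * (1 + fps_X * (fps_X ^ 2) ^ i)) * qfac (fps_X ^ 2) N)
      \<longlonglongrightarrow> odd_distinct_fps ^ 2 * fps_dilate 2 euler_fps"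
    by (simp only:) (intro tendsto_fps_mult tendsto_fps_power tendsto_odd_distinct_fps
        tendsto_qfac_X_power zero_less_numeral)
qed

text \<open>The triple product with \<open>Q = q\<close>, \<open>x = 1\<close>,
  \<open>y = q\<close>. Every triangular number arises twice, so the sum is \<open>2 * psi\<close>;
  the product supplies the same 2 by its factor \<open>1 + x * Q^0\<close>.\<close>

lemma psi_eq: "psi = distinct_fps ^ 2 * euler_fps"
proof -
  have mono: "strict_mono (\<lambda>n. Suc n choose 2)"
    by (simp add: strict_mono_Suc_iff numeral_2_eq_2)
  have "(\<lambda>N. (\<Sum>n<N. fps_X ^ (Suc n choose 2)) + ((\<Sum>n<Suc N. fps_X ^ (Suc n choose 2)) - 1)) \<longlonglongrightarrow>
      psi + (psi - 1)"
    unfolding psi_def diff_conv_add_uminus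
    by (intro tendsto_fps_add tendsto_const LIMSEQ_Suc tendsto_fps_of_set[OF mono])
  moreover have "(\<Sum>n<N. fps_X ^ (Suc n choose 2)) + ((\<Sum>n<Suc N. fps_X ^ (Suc n choose 2)) - 1) =
      (\<Sum>n<N. (1 ^ Suc n + fps_X ^ Suc n) * fps_X ^ (Suc n choose 2) :: int fps)" for N
    by (induction N) (simp_all add: numeral_2_eq_2 power_add algebra_simps)
  ultimately have "(\<lambda>N. \<Sum>n<N. (1 ^ Suc n + fps_X ^ Suc n) * fps_X ^ (Suc n choose 2)) \<longlonglongrightarrow> psi + (psi - 1)"
    by simp
  from jacobi_triple_product[OF _ _ this]
  have "(\<lambda>N. (\<Prod>i<N. (1 + 1 * fps_X ^ i) * (1 + fps_X * fps_X ^ i)) * qfac fps_X N) \<longlonglongrightarrow> 2 * psi"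
    by (simp del: One_nat_def)
  \<comment> \<open>With \<open>Suc N\<close> factors the one at index 0 is always present, and the
    2 can be taken out.\<close>
  from LIMSEQ_Suc[OF this]
  have 1: "(\<lambda>N. (\<Prod>i<Suc N. (1 + 1 * fps_X ^ i) * (1 + fps_X * fps_X ^ i)) * qfac fps_X (Suc N))
      \<longlonglongrightarrow> 2 * psi" .
  have "(\<Prod>i<Suc N. (1 + 1 * fps_X ^ i) * (1 + fps_X * fps_X ^ i)) =
      2 * ((\<Prod>i<N. 1 + fps_X ^ Suc i :: int fps) * (\<Prod>i<Suc N. 1 + fps_X ^ Suc i))" for N
    by (induction N) (simp_all add: algebra_simps)
  then have 2: "(\<lambda>N. (\<Prod>i<Suc N. (1 + 1 * fps_X ^ i) * (1 + fps_X * fps_X ^ i)) * qfac fps_X (Suc N))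
      \<longlonglongrightarrow> 2 * (distinct_fps * distinct_fps) * euler_fps"
    by (simp only:) (intro tendsto_fps_mult tendsto_const LIMSEQ_Suc[OF tendsto_qfac]
        tendsto_distinct_fps LIMSEQ_Suc[OF tendsto_distinct_fps])
  from LIMSEQ_unique[OF 1 2] show ?thesis by (simp add: power2_eq_square mult.assoc)
qed

section \<open>Dissections of theta series\<close>

definition fps_reflect :: "int fps \<Rightarrow> int fps" where
  "fps_reflect f = f oo (- fps_X)"

lemma fps_reflect_nth: "fps_reflect f $ n = (- 1) ^ n * f $ n"
  by (simp add: fps_reflect_def fps_compose_uminus')

lemma fps_reflect_simps:
  "fps_reflect (f + g) = fps_reflect f + fps_reflect g"
  "fps_reflect (f - g) = fps_reflect f - fps_reflect g"
  "fps_reflect (f * g) = fps_reflect f * fps_reflect g"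
  "fps_reflect (f ^ n) = fps_reflect f ^ n"
  "fps_reflect 1 = 1" "fps_reflect (numeral k) = numeral k" "fps_reflect fps_X = - fps_X"
  unfolding fps_reflect_def
  by (simp_all only: fps_compose_add_distrib fps_compose_sub_distrib fps_compose_1
      numeral_fps_const fps_const_compose)
    (simp_all add: fps_compose_mult_distrib fps_compose_power[symmetric] fps_X_fps_compose_startby0)

lemma fps_reflect_prod: "fps_reflect (prod f A) = (\<Prod>i\<in>A. fps_reflect (f i))"
  by (simp add: fps_reflect_def fps_compose_prod_distrib)

lemma fps_reflect_dilate: "even k \<Longrightarrow> k > 0 \<Longrightarrow> fps_reflect (fps_dilate k f) = fps_dilate k f"
  by (auto simp: fps_eq_iff fps_reflect_nth fps_dilate_nth)

lemma tendsto_fps_reflect: "(f \<longlongrightarrow> a) F \<Longrightarrow> ((\<lambda>x. fps_reflect (f x)) \<longlongrightarrow> fps_reflect a) F"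
  unfolding fps_reflect_def by (rule tendsto_fps_compose)

lemma fps_dilate_inject: "k > 0 \<Longrightarrow> fps_dilate k f = fps_dilate k g \<longleftrightarrow> f = g"
  by (metis (no_types) dvd_triv_left fps_dilate_nth fps_eq_iff nonzero_mult_div_cancel_left not_gr0)

definition phim :: "int fps" where
  "phim = fps_reflect phi"

lemma reflect_odd_distinct: "fps_reflect odd_distinct_fps = odd_euler_fps"
proof (rule LIMSEQ_unique[OF tendsto_fps_reflect[OF tendsto_odd_distinct_fps]])
  have "fps_reflect (\<Prod>i<N. 1 + fps_X ^ Suc (2 * i)) = (\<Prod>i<N. 1 - fps_X ^ Suc (2 * i))" for N
    by (simp only: fps_reflect_prod fps_reflect_simps) simp
  then show "(\<lambda>N. fps_reflect (\<Prod>i<N. 1 + fps_X ^ Suc (2 * i))) \<longlonglongrightarrow> odd_euler_fps"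
    by (simp only: tendsto_odd_euler_fps)
qed

lemma phim_eq: "phim = odd_euler_fps ^ 2 * fps_dilate 2 euler_fps"
  by (simp add: phim_def phi_eq fps_reflect_simps fps_reflect_dilate reflect_odd_distinct)

text \<open>Follows from \<open>(-q;q^2)_inf (q;q^2)_inf = (q^2;q^4)_inf\<close>. It drives the
  dissections: multiplying by a power of \<open>phi\<close> turns a power of \<open>phim\<close>
  into a series in \<open>q^2\<close>.\<close>

lemma phi_mult_phim: "phi * phim = fps_dilate 2 phim ^ 2"
proof -
  have "phi * phim = (odd_distinct_fps * odd_euler_fps * fps_dilate 2 euler_fps) ^ 2"
    unfolding phi_eq phim_eq by algebra
  also have "\<dots> = (fps_dilate 2 odd_euler_fps * fps_dilate 2 (odd_euler_fps * fps_dilate 2 euler_fps)) ^ 2"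
    by (simp only: odd_distinct_mult_odd_euler odd_euler_mult)
  also have "\<dots> = fps_dilate 2 phim ^ 2"
    unfolding phim_eq by (simp only: fps_dilate_mult fps_dilate_power zero_less_numeral) algebra
  finally show ?thesis .
qed

lemma psi_square: "psi ^ 2 = phi * fps_dilate 2 psi"
proof -
  have "psi ^ 2 = distinct_fps ^ 2 * (distinct_fps * euler_fps) ^ 2"
    unfolding psi_eq by algebra
  also have "\<dots> = (odd_distinct_fps * fps_dilate 2 distinct_fps) ^ 2 * fps_dilate 2 euler_fps ^ 2"
    by (simp only: odd_distinct_mult distinct_mult_euler)
  also have "\<dots> = phi * fps_dilate 2 psi"
    unfolding phi_eq psi_eq
    by (simp only: fps_dilate_mult fps_dilate_power zero_less_numeral) algebra
  finally show ?thesis .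
qed

text \<open>Together with \<open>psi_mult_euler\<close> this trades the final theta quotient for
  Euler products.\<close>

lemma phim_mult_euler: "phim * fps_dilate 2 euler_fps = euler_fps ^ 2"
proof -
  have "phim * fps_dilate 2 euler_fps = (odd_euler_fps * fps_dilate 2 euler_fps) ^ 2"
    unfolding phim_eq by algebra
  then show ?thesis by (simp only: odd_euler_mult)
qed

lemma psi_mult_euler: "psi * euler_fps = fps_dilate 2 euler_fps ^ 2"
proof -
  have "psi * euler_fps = (distinct_fps * euler_fps) ^ 2"
    unfolding psi_eq by algebra
  then show ?thesis by (simp only: distinct_mult_euler)
qed

lemma odd_square_iff: "odd n \<and> (\<exists>k. n = k ^ 2) \<longleftrightarrow> (\<exists>j. n = 8 * (Suc j choose 2) + 1)" for n :: nat
proof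
  have *: "8 * (Suc j choose 2) + 1 = (2 * j + 1) ^ 2" for j
  proof -
    have "2 * (Suc j choose 2) = Suc j * j" by (simp add: choose_two)
    then show ?thesis by (simp add: power2_eq_square algebra_simps)
  qed
  show "\<exists>j. n = 8 * (Suc j choose 2) + 1" if n: "odd n \<and> (\<exists>k. n = k ^ 2)"
  proof -
    obtain k where k: "n = k ^ 2" "odd k" using n by auto
    then obtain j where "k = 2 * j + 1" by (elim oddE)
    then have "n = 8 * (Suc j choose 2) + 1" using k(1) *[of j] by (simp only:)
    then show ?thesis by blast
  qed
  show "odd n \<and> (\<exists>k. n = k ^ 2)" if ex: "\<exists>j. n = 8 * (Suc j choose 2) + 1"
  proof -
    obtain j where j: "n = 8 * (Suc j choose 2) + 1" using ex by blast
    then have "odd n" by simp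
    moreover have "n = (2 * j + 1) ^ 2" unfolding j by (rule *)
    ultimately show ?thesis by blast
  qed
qed

text \<open>Even squares are \<open>4k^2\<close> and give \<open>phi(q^4)\<close>; odd squares are 8
  times a triangular number plus 1 and give \<open>2q psi(q^8)\<close>.\<close>

lemma phi_dissect: "phi = fps_dilate 4 phi + 2 * fps_X * fps_dilate 8 psi"
proof (rule fps_ext)
  fix n :: nat
  have two: "(2 * fps_X * f) $ i = (if i = 0 then 0 else 2 * f $ (i - 1))" for i and f :: "int fps"
    by (simp only: mult_2 ring_distribs fps_add_nth) simp
  have even: "4 dvd n" if "even n" "n = k ^ 2" for k
  proof -
    have "even k" using that by simp
    then obtain j where "k = 2 * j" by (elim evenE)
    with that show ?thesis by (simp add: power_mult_distrib)
  qed
  consider "n = 0" | "odd n" | "n \<noteq> 0" "4 dvd n" | "even n" "\<not> 4 dvd n" by blast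
  then show "phi $ n = (fps_dilate 4 phi + 2 * fps_X * fps_dilate 8 psi) $ n"
  proof cases
    case 1
    then show ?thesis by (simp add: two fps_dilate_nth)
  next
    case 2
    then have n: "n \<noteq> 0" "\<not> 4 dvd n" by presburger+
    have iff: "(\<exists>k. n = k ^ 2) \<longleftrightarrow> (\<exists>j. n = 8 * (Suc j choose 2) + 1)"
      using odd_square_iff[of n] 2 by simp
    have "n = 8 * m + 1 \<longleftrightarrow> 8 dvd n - 1 \<and> (n - 1) div 8 = m" for m
      using n by auto
    then have "(\<exists>k. n = k ^ 2) \<longleftrightarrow> 8 dvd n - 1 \<and> (\<exists>j. (n - 1) div 8 = Suc j choose 2)"
      unfolding iff by simp
    then show ?thesis using n by (simp add: two fps_dilate_nth phi_nth psi_nth)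
  next
    case 3
    then obtain m where m: "n = 4 * m" "m > 0" by (auto elim!: dvdE)
    have "(\<exists>k. n = k ^ 2) \<longleftrightarrow> (\<exists>k. m = k ^ 2)"
    proof
      assume "\<exists>k. n = k ^ 2"
      then obtain k where k: "n = k ^ 2" by blast
      have "even (k ^ 2)" unfolding k[symmetric] m(1) by simp
      then have "even k" by simp
      then obtain j where "k = 2 * j" by (elim evenE)
      then have "m = j ^ 2" using k m by (simp add: power_mult_distrib)
      then show "\<exists>k. m = k ^ 2" by blast
    next
      assume "\<exists>k. m = k ^ 2"
      then obtain k where "m = k ^ 2" by blast
      then have "n = (2 * k) ^ 2" using m by (simp add: power_mult_distrib)
      then show "\<exists>k. n = k ^ 2" by blast
    qed
    moreover have "\<not> 8 dvd n - 1" using m by presburger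
    ultimately show ?thesis using m by (simp add: two fps_dilate_nth phi_nth)
  next
    \<comment> \<open>Here \<open>n\<close> is 2 modulo 4, hence no square, and neither series on
      the right has such an exponent.\<close>
    case 4
    then have "odd (n - 1)" "n \<noteq> 0" by (cases n; simp)+
    then have "\<not> 8 dvd n - 1" using dvd_trans[of 2 8 "n - 1"] by auto
    moreover have "n \<noteq> k ^ 2" for k using 4 even[of k] by blast
    ultimately show ?thesis using 4 \<open>n \<noteq> 0\<close> by (simp add: two fps_dilate_nth phi_nth)
  qed
qed

text \<open>By \<open>phi_dissect\<close> and its reflection, \<open>phi * phim\<close> is a
  difference of squares; by \<open>phi_mult_phim\<close> it is \<open>phi(-q^2)^2\<close>. Replacing
  \<open>q^2\<close> by \<open>q\<close> gives the second identity, and reflection then gives the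
  first.\<close>

lemma phi_phim_square:
  "phi ^ 2 = fps_dilate 2 phi ^ 2 + 4 * fps_X * fps_dilate 4 psi ^ 2"
  "phim ^ 2 = fps_dilate 2 phi ^ 2 - 4 * fps_X * fps_dilate 4 psi ^ 2"
proof -
  have "phim = fps_reflect (fps_dilate 4 phi + 2 * fps_X * fps_dilate 8 psi)"
    unfolding phim_def using phi_dissect by (rule arg_cong)
  also have "\<dots> = fps_dilate 4 phi - 2 * fps_X * fps_dilate 8 psi"
    by (simp add: fps_reflect_simps fps_reflect_dilate)
  finally have phim: "phim = fps_dilate 4 phi - 2 * fps_X * fps_dilate 8 psi" .
  have "fps_dilate 2 (phim ^ 2) = phi * phim"
    by (simp add: phi_mult_phim fps_dilate_simps)
  also have "\<dots> = (fps_dilate 4 phi + 2 * fps_X * fps_dilate 8 psi) * phim"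
    using phi_dissect by (rule arg_cong)
  also have "\<dots> = fps_dilate 2 (fps_dilate 2 phi ^ 2 - 4 * fps_X * fps_dilate 4 psi ^ 2)"
    unfolding phim
    by (simp only: fps_dilate_simps zero_less_numeral) (simp, algebra)
  finally show *: "phim ^ 2 = fps_dilate 2 phi ^ 2 - 4 * fps_X * fps_dilate 4 psi ^ 2"
    by (simp add: fps_dilate_inject)
  have "fps_reflect phim = phi"
    by (simp add: fps_eq_iff phim_def fps_reflect_nth flip: mult.assoc power_add mult_2)
  then have "phi ^ 2 = fps_reflect (phim ^ 2)" by (simp add: fps_reflect_simps)
  also have "\<dots> = fps_dilate 2 phi ^ 2 + 4 * fps_X * fps_dilate 4 psi ^ 2"
    unfolding * by (simp add: fps_reflect_simps fps_reflect_dilate)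
  finally show "phi ^ 2 = fps_dilate 2 phi ^ 2 + 4 * fps_X * fps_dilate 4 psi ^ 2" .
qed

text \<open>Jacobi's quartic identity. The squares of \<open>phi\<close> and \<open>phim\<close>
  have difference \<open>8q psi(q^4)^2\<close> and sum \<open>2 phi(q^2)^2\<close>;
  \<open>psi_square\<close> merges the product.\<close>

lemma phi_quartic: "phi ^ 4 - phim ^ 4 = 16 * fps_X * fps_dilate 2 psi ^ 4"
proof -
  have "phi ^ 4 - phim ^ 4 = (phi ^ 2 - phim ^ 2) * (phi ^ 2 + phim ^ 2)"
    by algebra
  also have "\<dots> = 16 * fps_X * fps_dilate 2 (phi * fps_dilate 2 psi) ^ 2"
    unfolding phi_phim_square
    by (simp only: fps_dilate_simps zero_less_numeral) (simp, algebra)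
  also have "\<dots> = 16 * fps_X * fps_dilate 2 psi ^ 4"
    unfolding psi_square[symmetric] by (simp add: fps_dilate_power flip: power_mult)
  finally show ?thesis .
qed

section \<open>Exponents of \<open>psi\<close> and of the Euler product modulo 5\<close>

lemma choose_two_mod_5: "(k choose 2) mod 5 = ((k mod 5) choose 2) mod 5"
proof -
  have "(5 * m + r choose 2) mod 5 = (r choose 2) mod 5" for m r :: nat
  proof (induction m)
    case (Suc m)
    have "5 * Suc m + r choose 2 = (5 * m + r choose 2) + 5 * (5 * m + r + 2)"
      by (simp add: numeral_eq_Suc)
    then show ?case using Suc
      by (simp only: mod_mult_self2)
  qed simp
  from this[of "k div 5" "k mod 5"] show ?thesis by simp
qed

lemma choose_two_mod_5_cases:
  obtains "k mod 5 = 0" "(k choose 2) mod 5 = 0" | "k mod 5 = 1" "(k choose 2) mod 5 = 0"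
    | "k mod 5 = 2" "(k choose 2) mod 5 = 1" | "k mod 5 = 3" "(k choose 2) mod 5 = 3"
    | "k mod 5 = 4" "(k choose 2) mod 5 = 1"
proof -
  consider "k mod 5 = 0" | "k mod 5 = 1" | "k mod 5 = 2" | "k mod 5 = 3" | "k mod 5 = 4"
    by linarith
  moreover have "0 choose 2 = (0::nat)" "1 choose 2 = (0::nat)" "2 choose 2 = (1::nat)"
    "3 choose 2 = (3::nat)" "4 choose 2 = (6::nat)"
    by (simp_all add: choose_two binomial_eq_0)
  ultimately show thesis
    using that choose_two_mod_5[of k] by cases (simp_all only:, simp_all)
qed

lemma psi_support:
  assumes "n mod 5 \<in> {2, 4}"
  shows "psi $ n = 0"
proof -
  have "(k choose 2) mod 5 \<notin> {2, 4}" for k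
    by (cases k rule: choose_two_mod_5_cases) auto
  with assms show ?thesis by (auto simp: psi_nth)
qed

text \<open>The pentagonal number theorem, from the triple product with \<open>Q = q^3\<close>,
  \<open>x = -q\<close>, \<open>y = -q^2\<close>. The exponents \<open>k(3k-1)/2\<close> and
  \<open>k(3k+1)/2\<close> are 0, 1 or 2 modulo 5.\<close>

lemma euler_support:
  assumes "n mod 5 \<in> {3, 4}"
  shows "euler_fps $ n = 0"
proof -
  define Q x y :: "int fps" where "Q = fps_X ^ 3" and "x = - fps_X" and "y = - (fps_X ^ 2)"
  define f where "f = (\<lambda>n. (x ^ Suc n + y ^ Suc n) * Q ^ (Suc n choose 2))"
  have f: "f n = (- 1) ^ Suc n * (fps_X ^ (Suc n + 3 * (Suc n choose 2))
      + fps_X ^ (2 * Suc n + 3 * (Suc n choose 2)))" for n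
    unfolding f_def x_def y_def Q_def power_minus[of fps_X] power_minus[of "fps_X ^ 2"]
    by (simp only: power_add power_mult[symmetric] ring_distribs mult_ac)
  have dvd: "fps_X ^ n dvd f n" for n
    unfolding f by (intro dvd_mult dvd_add le_imp_power_dvd) auto
  have "Q $ 0 = 0" "x * y = Q"
    by (simp_all add: Q_def x_def y_def power3_eq_cube power2_eq_square)
  from jacobi_triple_product[OF this sums_fps[of f, OF dvd, unfolded sums_def f_def]]
  have "(\<lambda>N. (\<Prod>i<N. (1 + x * Q ^ i) * (1 + y * Q ^ i)) * qfac Q N) \<longlonglongrightarrow>
      1 + Abs_fps (\<lambda>m. \<Sum>n\<le>m. f n $ m)"
    unfolding f_def .
  \<comment> \<open>Index \<open>i\<close> contributes the factors with exponents
    \<open>3i+1\<close>, \<open>3i+2\<close> and \<open>3i+3\<close>.\<close>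
  moreover have "(\<Prod>i<N. (1 + x * Q ^ i) * (1 + y * Q ^ i)) * qfac Q N = qfac fps_X (3 * N)" for N
  proof (induction N)
    case (Suc N)
    have Q: "Q ^ k = fps_X ^ (3 * k)" for k
      by (simp add: Q_def flip: power_mult)
    have e: "3 * Suc N = Suc (Suc (Suc (3 * N)))" by simp
    then have "1 - fps_X ^ Suc (3 * N) = 1 + x * Q ^ N" "1 - fps_X ^ Suc (Suc (3 * N)) = 1 + y * Q ^ N"
      "1 - fps_X ^ Suc (Suc (Suc (3 * N))) = 1 - Q ^ Suc N"
      unfolding Q by (simp_all add: x_def y_def power2_eq_square mult.assoc
          del: mult_Suc_right)
    then have "qfac fps_X (3 * Suc N) =
        qfac fps_X (3 * N) * (1 + x * Q ^ N) * (1 + y * Q ^ N) * (1 - Q ^ Suc N)"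
      by (simp only: e qfac_Suc)
    then show ?case
      unfolding Suc[symmetric] prod.lessThan_Suc qfac_Suc[of Q] by (simp only: mult_ac)
  qed simp
  ultimately have "(\<lambda>N. qfac fps_X (3 * N)) \<longlonglongrightarrow> 1 + Abs_fps (\<lambda>m. \<Sum>n\<le>m. f n $ m)" by simp
  from LIMSEQ_unique[OF filterlim_subseq_mult[OF tendsto_qfac] this]
  have eq: "euler_fps = 1 + Abs_fps (\<lambda>m. \<Sum>n\<le>m. f n $ m)" by simp
  have "(k + 3 * (k choose 2)) mod 5 \<notin> {3, 4} \<and> (2 * k + 3 * (k choose 2)) mod 5 \<notin> {3, 4}" for k
  proof -
    have "(k + 3 * (k choose 2)) mod 5 = (k mod 5 + 3 * ((k choose 2) mod 5)) mod 5"
      "(2 * k + 3 * (k choose 2)) mod 5 = (2 * (k mod 5) + 3 * ((k choose 2) mod 5)) mod 5"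
      by (intro mod_add_cong mod_mult_cong; simp)+
    then show ?thesis by (cases k rule: choose_two_mod_5_cases) simp_all
  qed
  then have "n \<noteq> Suc k + 3 * (Suc k choose 2)" "n \<noteq> 2 * Suc k + 3 * (Suc k choose 2)" for k
    using assms by metis+
  then have "f k $ n = 0" for k
    unfolding f by (cases "even (Suc k)") (simp_all add: fps_X_power_nth del: power_Suc mult_Suc_right)
  then show ?thesis using assms unfolding eq by auto
qed

section \<open>The even part of the generating function\<close>

lemma prod_diff_dvd:
  fixes f g :: "'b \<Rightarrow> 'a::comm_ring_1"
  assumes "\<And>i. d dvd f i - g i"
  shows "d dvd prod f A - prod g A"
proof (induction A rule: infinite_finite_induct)
  case (insert a A)
  have "prod f (insert a A) - prod g (insert a A) =
      (f a - g a) * prod f A + g a * (prod f A - prod g A)"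
    using insert by (simp add: algebra_simps)
  then show ?case using assms[of a] insert.IH by (metis dvd_add dvd_mult dvd_mult2)
qed simp_all

lemma fps_right_inverse_mult:
  fixes f g :: "'a::comm_ring_1 fps"
  assumes "f $ 0 = 1" "g $ 0 = 1"
  shows "fps_right_inverse f 1 = g * fps_right_inverse (f * g) 1"
proof -
  have "fps_right_inverse f 1 = fps_right_inverse f 1 * (f * g * fps_right_inverse (f * g) 1)"
    using assms fps_right_inverse_1[of "f * g"] by simp
  also have "\<dots> = (f * fps_right_inverse f 1) * (g * fps_right_inverse (f * g) 1)"
    by (simp only: mult_ac)
  also have "\<dots> = g * fps_right_inverse (f * g) 1"
    using assms by (simp add: fps_right_inverse_1)
  finally show ?thesis .
qed

text \<open>
  The generating function of \<open>v0\<close> is \<open>mock_sum 0\<close>. Raising \<open>k\<close> replaces \<open>q^(-1)\<close> by \<open>q^(2k-1)\<close>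
  in \<open>q^(n^2) (-q;q^2)_n / (q;q^2)_n = q^(n(n+1)) (q^(-1) + 1) \<dots> (q^(-1) + q^(2n-2)) / (q;q^2)_n\<close>
  and \<open>(q;q^2)_n\<close> by \<open>(q^(2k+1);q^2)_n\<close>.
\<close>

definition mock_num :: "nat \<Rightarrow> nat \<Rightarrow> int fps" where
  "mock_num k n = (\<Prod>i<n. fps_X ^ (2 * i + 1) + fps_X ^ (2 * k))"

definition mock_den :: "nat \<Rightarrow> nat \<Rightarrow> int fps" where
  "mock_den k n = (\<Prod>i<n. 1 - fps_X ^ (2 * k + 2 * i + 1))"

definition mock_inv :: "nat \<Rightarrow> nat \<Rightarrow> int fps" where
  "mock_inv k n = fps_right_inverse (mock_den k n) 1"

definition mock_term :: "nat \<Rightarrow> nat \<Rightarrow> int fps" where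
  "mock_term k n = fps_X ^ (n ^ 2) * mock_num k n * mock_inv k n"

definition mock_sum :: "nat \<Rightarrow> int fps" where
  "mock_sum k = (\<Sum>n. mock_term k n)"

lemma v0_term_eq: "v0_term n = mock_term 0 n"
proof -
  have "qpoch (- fps_X) (fps_X ^ 2) n = mock_num 0 n"
    unfolding qpoch_def mock_num_def
    by (rule prod.reindex_bij_witness[of _ Suc "\<lambda>i. i - 1"]) (auto simp flip: power_mult)
  moreover have "qpoch fps_X (fps_X ^ 2) n = mock_den 0 n"
    unfolding qpoch_def mock_den_def
    by (rule prod.reindex_bij_witness[of _ Suc "\<lambda>i. i - 1"]) (auto simp flip: power_mult)
  ultimately show ?thesis by (simp add: v0_term_def mock_term_def mock_inv_def)
qed

lemma mock_den_Suc: "mock_den k (Suc n) = mock_den k n * (1 - fps_X ^ (2 * k + 2 * n + 1))"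
  by (simp add: mock_den_def)

lemma mock_den_Suc': "mock_den k (Suc n) = mock_den (Suc k) n * (1 - fps_X ^ (2 * k + 1))"
  unfolding mock_den_def prod.lessThan_Suc_shift by (simp add: mult.commute)

lemma mock_den_nth_0 [simp]: "mock_den k n $ 0 = 1"
  by (induction n) (simp_all add: mock_den_def)

lemma mock_inv_Suc: "mock_inv k n = (1 - fps_X ^ (2 * k + 2 * n + 1)) * mock_inv k (Suc n)"
  unfolding mock_inv_def mock_den_Suc by (rule fps_right_inverse_mult) simp_all

lemma mock_inv_Suc': "mock_inv (Suc k) n = (1 - fps_X ^ (2 * k + 1)) * mock_inv k (Suc n)"
  unfolding mock_inv_def mock_den_Suc' by (rule fps_right_inverse_mult) simp_all

lemma mock_num_Suc: "mock_num k (Suc n) = mock_num k n * (fps_X ^ (2 * n + 1) + fps_X ^ (2 * k))"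
  by (simp add: mock_num_def)

text \<open>Beyond the first, the factors on the left are \<open>q^2\<close> times those of
  \<open>mock_num k n\<close>; the first is \<open>q + q^(2k+2) = q (1 + q^(2k+1))\<close>.\<close>

lemma mock_num_Suc':
  "mock_num (Suc k) (Suc n) = fps_X ^ (2 * n + 1) * (1 + fps_X ^ (2 * k + 1)) * mock_num k n"
proof (induction n)
  case 0
  then show ?case by (simp add: mock_num_def algebra_simps)
next
  case (Suc n)
  have "fps_X ^ (2 * Suc n + 1) + fps_X ^ (2 * Suc k) =
      fps_X ^ 2 * (fps_X ^ (2 * n + 1) + fps_X ^ (2 * k) :: int fps)"
    "fps_X ^ (2 * Suc n + 1) = (fps_X ^ 2 * fps_X ^ (2 * n + 1) :: int fps)"
    by (simp_all add: algebra_simps power2_eq_square)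
  then show ?case
    unfolding mock_num_Suc[of "Suc k" "Suc n"] Suc mock_num_Suc[of k n] by (simp only: mult_ac)
qed

text \<open>Let \<open>G(N)\<close> be the last product on the right. Then
  \<open>(1 - a^2) t_k(N+1) - (1 + a^2) t_(k+1)(N+1) = G(N) - G(N+1)\<close> for the summands
  \<open>t\<close>, and \<open>a (1 - a)\<close> comes from the start of the sum.\<close>

lemma mock_sum_telescope:
  defines "a k \<equiv> fps_X ^ (2 * k + 1)"
  shows "(1 - a k ^ 2) * (\<Sum>n<Suc N. mock_term k n) =
    (1 + a k ^ 2) * (\<Sum>n<Suc N. mock_term (Suc k) n) + a k * (1 - a k)
    - (1 - a k ^ 2) * fps_X ^ (2 * k) * fps_X ^ ((Suc N) ^ 2) * mock_num k N * mock_inv k (Suc N)"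
proof (induction N)
  case 0
  have inv: "mock_inv j 0 = 1" and num: "mock_num j 0 = 1" for j
    using fps_right_inverse_1[of "mock_den j 0"] by (simp_all add: mock_inv_def mock_den_def mock_num_def)
  define d f where "d = mock_inv k (Suc 0)" and "f = (fps_X ^ (2 * k) :: int fps)"
  have a: "a k = fps_X * f" by (simp add: a_def f_def)
  have d: "(1 - a k) * d = 1"
    using mock_inv_Suc[of k 0] by (simp add: inv a_def d_def)
  have "(1 - a k ^ 2) * f * fps_X * d = a k * (1 + a k) * ((1 - a k) * d)"
    unfolding a by algebra
  also have "\<dots> = a k * (1 + a k)" unfolding d by simp
  finally have "(1 - a k ^ 2) * 1 = (1 + a k ^ 2) * 1 + a k * (1 - a k) - (1 - a k ^ 2) * f * fps_X * d"
    by (simp add: algebra_simps power2_eq_square)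
  then show ?case by (simp add: mock_term_def inv num d_def f_def)
next
  case (Suc N)
  let ?t = mock_term
  define e f P num d where "e = (fps_X ^ (2 * N + 1) :: int fps)" and "f = (fps_X ^ (2 * k) :: int fps)"
    and "P = (fps_X ^ ((Suc N) ^ 2) :: int fps)" and "num = mock_num k N"
    and "d = mock_inv k (Suc (Suc N))"
  have a: "a k = fps_X * f" by (simp add: a_def f_def)
  have X: "fps_X ^ (2 * k + 2 * Suc N + 1) = f * e * fps_X ^ 2"
    by (simp add: e_def f_def power2_eq_square power_add mult_ac)
  have P: "fps_X ^ ((Suc (Suc N)) ^ 2) = P * e * fps_X ^ 2"
  proof -
    have eq: "(Suc (Suc N)) ^ 2 = (Suc N) ^ 2 + (2 * N + 1) + 2" by (simp add: power2_eq_square)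
    show ?thesis unfolding eq P_def e_def power_add ..
  qed
  have inv: "mock_inv k (Suc N) = (1 - f * e * fps_X ^ 2) * d"
    unfolding d_def mock_inv_Suc[of k "Suc N"] X by simp
  have num: "mock_num k (Suc N) = num * (e + f)"
    by (simp add: mock_num_Suc num_def e_def f_def)
  have t: "?t k (Suc N) = P * (num * (e + f)) * ((1 - f * e * fps_X ^ 2) * d)"
    unfolding mock_term_def inv num P_def ..
  have t': "?t (Suc k) (Suc N) = P * (e * (1 + a k) * num) * ((1 - a k) * d)"
    unfolding mock_term_def mock_num_Suc' mock_inv_Suc' P_def e_def num_def d_def a_def ..
  \<comment> \<open>In the common quantities \<open>e\<close>, \<open>f\<close>, \<open>P\<close>,
    \<open>num\<close> and \<open>d\<close> the telescoping relation is a polynomial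
    identity.\<close>
  have key: "(1 - a k ^ 2) * ?t k (Suc N) - (1 + a k ^ 2) * ?t (Suc k) (Suc N) =
      (1 - a k ^ 2) * f * P * num * ((1 - f * e * fps_X ^ 2) * d)
      - (1 - a k ^ 2) * f * (P * e * fps_X ^ 2) * (num * (e + f)) * d"
    unfolding t t' a by algebra
  have step: "c * (S + t) = c' * (S' + t') + r - h"
    if "c * S = c' * S' + r - g" "c * t - c' * t' = g - h" for c c' S S' t t' r g h :: "int fps"
    using that by algebra
  have IH: "(1 - a k ^ 2) * (\<Sum>n<Suc N. ?t k n) = (1 + a k ^ 2) * (\<Sum>n<Suc N. ?t (Suc k) n)
      + a k * (1 - a k) - (1 - a k ^ 2) * f * P * num * ((1 - f * e * fps_X ^ 2) * d)"
    using Suc.IH unfolding inv num_def f_def P_def .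
  show ?case
    unfolding sum.lessThan_Suc[of _ "Suc N"] num P d_def[symmetric] f_def[symmetric]
    by (rule step[OF IH key])
qed

lemma mock_term_dvd: "fps_X ^ n dvd mock_term k n"
proof -
  have "n \<le> n ^ 2" by (simp add: power2_eq_square)
  then show ?thesis unfolding mock_term_def mult.assoc
    by (intro dvd_mult2 le_imp_power_dvd)
qed

lemma mock_term_sums: "mock_term k sums mock_sum k"
  unfolding mock_sum_def by (rule summable_sums[OF sums_summable[OF sums_fps[OF mock_term_dvd]]])

text \<open>The boundary product of the telescoped sum is divisible by \<open>q^((N+1)^2)\<close>
  and disappears in the limit.\<close>

lemma mock_sum_Suc:
  defines "a k \<equiv> fps_X ^ (2 * k + 1)"
  shows "(1 - a k ^ 2) * mock_sum k = (1 + a k ^ 2) * mock_sum (Suc k) + a k * (1 - a k)"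
proof (rule LIMSEQ_unique)
  have lim: "(\<lambda>N. \<Sum>n<Suc N. mock_term j n) \<longlonglongrightarrow> mock_sum j" for j
    using LIMSEQ_Suc[OF mock_term_sums[unfolded sums_def]] .
  show "(\<lambda>N. (1 - a k ^ 2) * (\<Sum>n<Suc N. mock_term k n)) \<longlonglongrightarrow> (1 - a k ^ 2) * mock_sum k"
    by (intro tendsto_fps_mult tendsto_const lim)
  have "(\<lambda>N. (1 + a k ^ 2) * (\<Sum>n<Suc N. mock_term (Suc k) n) + a k * (1 - a k)) \<longlonglongrightarrow>
      (1 + a k ^ 2) * mock_sum (Suc k) + a k * (1 - a k)"
    by (intro tendsto_fps_add tendsto_fps_mult tendsto_const lim)
  then show "(\<lambda>N. (1 - a k ^ 2) * (\<Sum>n<Suc N. mock_term k n)) \<longlonglongrightarrow>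
      (1 + a k ^ 2) * mock_sum (Suc k) + a k * (1 - a k)"
  proof (rule tendsto_fps_close)
    fix N
    have "fps_X ^ N dvd (fps_X ^ ((Suc N) ^ 2) :: int fps)"
      by (rule le_imp_power_dvd) (simp add: power2_eq_square)
    then show "fps_X ^ N dvd (1 - a k ^ 2) * (\<Sum>n<Suc N. mock_term k n) -
        ((1 + a k ^ 2) * (\<Sum>n<Suc N. mock_term (Suc k) n) + a k * (1 - a k))"
      unfolding mock_sum_telescope[of k N, folded a_def]
      by (simp del: sum.lessThan_Suc add: mult.assoc dvd_mult)
  qed
qed

section \<open>The symmetrized sums and their product formula\<close>

definition mock_even :: "nat \<Rightarrow> int fps" where
  "mock_even k = mock_sum k + fps_reflect (mock_sum k) - 1"

text \<open>Reflection changes \<open>a\<close> to \<open>-a\<close>, so the inhomogeneous parts add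
  up to \<open>-2a^2 = (1 - a^2) - (1 + a^2)\<close>. This is what the \<open>- 1\<close> in
  \<open>mock_even\<close> absorbs.\<close>

lemma mock_even_Suc:
  "(1 - fps_X ^ (4 * k + 2)) * mock_even k = (1 + fps_X ^ (4 * k + 2)) * mock_even (Suc k)"
proof -
  define a where "a = (fps_X ^ (2 * k + 1) :: int fps)"
  have "4 * k + 2 = (2 * k + 1) * 2" by simp
  then have a2: "fps_X ^ (4 * k + 2) = a ^ 2" by (simp only: a_def power_mult)
  have ra: "fps_reflect a = - a" by (simp add: a_def fps_reflect_simps del: power_Suc)
  have 1: "(1 - a ^ 2) * mock_sum k = (1 + a ^ 2) * mock_sum (Suc k) + a * (1 - a)"
    using mock_sum_Suc[of k] by (simp add: a_def)
  from arg_cong[OF 1, of fps_reflect]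
  have "(1 - a ^ 2) * fps_reflect (mock_sum k) =
      (1 + a ^ 2) * fps_reflect (mock_sum (Suc k)) + (- a) * (1 + a)"
    by (simp only: fps_reflect_simps ra) simp
  with 1 show ?thesis unfolding mock_even_def a2 by algebra
qed

text \<open>The recurrence iterated \<open>K\<close> times; its exponents \<open>4i+2\<close> are
  twice the odd numbers.\<close>

lemma mock_even_0:
  "fps_dilate 2 (\<Prod>i<K. 1 - fps_X ^ Suc (2 * i)) * mock_even 0 =
   fps_dilate 2 (\<Prod>i<K. 1 + fps_X ^ Suc (2 * i)) * mock_even K"
proof (induction K)
  case (Suc K)
  have "fps_dilate 2 (fps_X ^ Suc (2 * K)) = fps_X ^ (4 * K + 2)"
    by (simp only: fps_dilate_simps zero_less_numeral power_mult[symmetric]) simp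
  then have "fps_dilate 2 (\<Prod>i<Suc K. 1 - fps_X ^ Suc (2 * i)) * mock_even 0 =
      (1 - fps_X ^ (4 * K + 2)) * (fps_dilate 2 (\<Prod>i<K. 1 - fps_X ^ Suc (2 * i)) * mock_even 0)"
    "fps_dilate 2 (\<Prod>i<Suc K. 1 + fps_X ^ Suc (2 * i)) * mock_even (Suc K) =
      (\<Prod>i<K. fps_dilate 2 (1 + fps_X ^ Suc (2 * i))) * ((1 + fps_X ^ (4 * K + 2)) * mock_even (Suc K))"
    by (simp_all only: prod.lessThan_Suc fps_dilate_mult fps_dilate_prod fps_dilate_add fps_dilate_diff
        fps_dilate_1 zero_less_numeral mult_ac)
  then show ?case unfolding Suc mock_even_Suc[symmetric]
    by (simp only: fps_dilate_prod zero_less_numeral mult_ac)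
qed (simp add: fps_dilate_1)

text \<open>Modulo \<open>q^(2k)\<close> the denominator is 1 and the numerator factors are
  \<open>q^(2i+1)\<close>, with product \<open>q^(n^2)\<close>.\<close>

lemma mock_term_approx: "fps_X ^ (2 * k) dvd mock_term k n - fps_X ^ (2 * n ^ 2)"
proof -
  have "(\<Prod>i<n. fps_X ^ (2 * i + 1) :: int fps) = fps_X ^ (n ^ 2)"
  proof (induction n)
    case (Suc n)
    have eq: "(Suc n) ^ 2 = n ^ 2 + (2 * n + 1)" by (simp add: power2_eq_square)
    show ?case unfolding eq prod.lessThan_Suc Suc.IH by (rule power_add[symmetric])
  qed simp
  moreover have "fps_X ^ (2 * k) dvd mock_num k n - (\<Prod>i<n. fps_X ^ (2 * i + 1))"
    unfolding mock_num_def by (rule prod_diff_dvd) simp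
  ultimately have 1: "fps_X ^ (2 * k) dvd mock_num k n - fps_X ^ (n ^ 2)" by simp
  have "fps_X ^ (2 * k) dvd mock_den k n - (\<Prod>i<n. 1)"
    unfolding mock_den_def by (rule prod_diff_dvd) (simp add: le_imp_power_dvd del: power_Suc)
  then have "fps_X ^ (2 * k) dvd mock_inv k n * (mock_den k n - 1)" by simp
  also have "mock_inv k n * (mock_den k n - 1) = 1 - mock_inv k n"
    using fps_right_inverse_1[of "mock_den k n"] by (simp add: mock_inv_def algebra_simps)
  finally have 2: "fps_X ^ (2 * k) dvd 1 - mock_inv k n" .
  have "mock_term k n - fps_X ^ (2 * n ^ 2) =
      fps_X ^ (n ^ 2) * mock_inv k n * (mock_num k n - fps_X ^ (n ^ 2))
      - fps_X ^ (2 * n ^ 2) * (1 - mock_inv k n)"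
    by (simp add: mock_term_def algebra_simps mult_2 power_add)
  with 1 2 show ?thesis by (metis dvd_diff dvd_mult)
qed

text \<open>The sums tend to \<open>C\<close>, the sum of \<open>q^(2n^2)\<close> over
  \<open>n \<ge> 0\<close>. It has even exponents only, so reflection fixes it and
  \<open>2C - 1 = phi(q^2)\<close>.\<close>

lemma tendsto_mock_even: "mock_even \<longlonglongrightarrow> fps_dilate 2 phi"
proof -
  define C where "C = fps_of_set (range (\<lambda>n. 2 * n ^ 2))"
  have "strict_mono (\<lambda>n::nat. 2 * n ^ 2)" by (simp add: strict_mono_def power_strict_mono)
  from tendsto_fps_of_set[OF this] have "(\<lambda>n. fps_X ^ (2 * n ^ 2)) sums C"
    by (simp add: sums_def C_def)
  moreover have dvd: "fps_X ^ n dvd (fps_X ^ (2 * n ^ 2) :: int fps)" for n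
    by (rule le_imp_power_dvd) (simp add: power2_eq_square)
  ultimately have C: "C $ m = (\<Sum>n\<le>m. fps_X ^ (2 * n ^ 2) $ m)" for m
    using suminf_fps_nth[of "\<lambda>n. fps_X ^ (2 * n ^ 2) :: int fps" m] by (simp add: sums_iff)
  have "mock_sum \<longlonglongrightarrow> C"
  proof (rule tendsto_fps_close[OF tendsto_const])
    fix k
    have "mock_sum k $ m = C $ m" if "m < k" for m
      unfolding C mock_sum_def suminf_fps_nth[of "mock_term k", OF mock_term_dvd]
      using mock_term_approx[of k] that
      by (intro sum.cong refl) (auto simp: fps_X_power_dvd_iff)
    then show "fps_X ^ k dvd mock_sum k - C" by (simp add: fps_X_power_dvd_iff)
  qed
  then have "(\<lambda>k. mock_sum k + fps_reflect (mock_sum k) + (- 1)) \<longlonglongrightarrow> C + fps_reflect C + (- 1)"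
    by (intro tendsto_fps_add tendsto_fps_reflect tendsto_const)
  moreover have "C + fps_reflect C + (- 1) = fps_dilate 2 phi"
  proof (rule fps_ext)
    fix n
    show "(C + fps_reflect C + (- 1)) $ n = fps_dilate 2 phi $ n"
    proof (cases "even n")
      case True
      then obtain m where m: "n = 2 * m" by (elim evenE)
      then have "n \<in> range (\<lambda>n. 2 * n ^ 2) \<longleftrightarrow> (\<exists>k. m = k ^ 2)" by auto
      then show ?thesis using m by (simp add: fps_dilate_nth fps_reflect_nth C_def fps_of_set_def phi_nth)
    next
      case False
      then have "n \<notin> range (\<lambda>n. 2 * n ^ 2)" "n \<noteq> 0" by (auto simp: odd_pos)
      then show ?thesis using False by (simp add: fps_dilate_nth fps_reflect_nth C_def fps_of_set_def)
    qed
  qed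
  ultimately show ?thesis by (simp add: mock_even_def[abs_def])
qed

lemma v0_even_part:
  defines "V \<equiv> Abs_fps v0"
  shows "fps_dilate 2 odd_euler_fps * (V + fps_reflect V - 1) = fps_dilate 2 (odd_distinct_fps * phi)"
proof -
  have "V = mock_sum 0"
    unfolding V_def v0_def mock_sum_def v0_term_eq by (simp add: fps_nth_inverse)
  then have V: "V + fps_reflect V - 1 = mock_even 0" by (simp add: mock_even_def)
  have "(\<lambda>K. fps_dilate 2 (\<Prod>i<K. 1 - fps_X ^ Suc (2 * i)) * mock_even 0) \<longlonglongrightarrow>
      fps_dilate 2 odd_euler_fps * mock_even 0"
    by (intro tendsto_fps_mult tendsto_fps_dilate tendsto_odd_euler_fps tendsto_const)
  moreover have "(\<lambda>K. fps_dilate 2 (\<Prod>i<K. 1 - fps_X ^ Suc (2 * i)) * mock_even 0) \<longlonglongrightarrow>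
      fps_dilate 2 odd_distinct_fps * fps_dilate 2 phi"
    unfolding mock_even_0
    by (intro tendsto_fps_mult tendsto_fps_dilate tendsto_odd_distinct_fps tendsto_mock_even)
  ultimately show ?thesis unfolding V fps_dilate_mult[OF zero_less_numeral] by (rule LIMSEQ_unique)
qed

section \<open>Dissection of the even part and congruences\<close>

lemma fps_nth_euler_0 [simp]: "euler_fps $ 0 = 1"
  by (simp add: euler_fps_def fps_inf_prod_def)

lemma fps_nth_eq_1_imp_nonzero: "f $ 0 = (1::int) \<Longrightarrow> f \<noteq> 0"
  by auto

lemma phim_nth_0 [simp]: "phim $ 0 = 1"
  by (simp add: phim_def fps_reflect_nth phi_nth)

text \<open>Stated after replacing \<open>q^2\<close> by \<open>q\<close>. Multiplying
  \<open>?M * T = ?O * phi\<close> by \<open>phi(-q^2) = ?O * ?M * ?F\<close> produces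
  \<open>?O^2 * ?F = phi\<close>, and \<open>?M\<close> cancels.\<close>

lemma v0_even:
  defines "T \<equiv> Abs_fps (\<lambda>n. 2 * v0 (2 * n)) - 1"
  shows "T * fps_dilate 2 phim = phi ^ 2"
proof -
  let ?M = odd_euler_fps and ?O = odd_distinct_fps and ?F = "fps_dilate 2 euler_fps"
  have "Abs_fps v0 + fps_reflect (Abs_fps v0) - 1 = fps_dilate 2 T"
    by (auto simp: fps_eq_iff fps_reflect_nth fps_dilate_nth T_def)
  with v0_even_part have "fps_dilate 2 (?M * T) = fps_dilate 2 (?O * phi)"
    by (simp add: fps_dilate_mult)
  then have T: "?M * T = ?O * phi" by (simp add: fps_dilate_inject)
  have phim: "fps_dilate 2 phim = ?O * ?M * ?F"
  proof -
    have "fps_dilate 2 phim = fps_dilate 2 ?M * fps_dilate 2 (?M * ?F)"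
      unfolding phim_eq by (simp only: fps_dilate_mult fps_dilate_power zero_less_numeral) algebra
    then show ?thesis by (simp only: odd_euler_mult odd_distinct_mult_odd_euler)
  qed
  have "?M * (T * fps_dilate 2 phim) = (?M * T) * (?O * ?M * ?F)"
    unfolding phim by (simp only: mult_ac)
  also have "\<dots> = ?M * (phi * (?O ^ 2 * ?F))"
    unfolding T by algebra
  also have "\<dots> = ?M * phi ^ 2"
    by (simp only: phi_eq[symmetric] power2_eq_square[of phi])
  finally have "?M * (T * fps_dilate 2 phim) = ?M * phi ^ 2" .
  moreover have "?M \<noteq> 0"
    by (rule fps_nth_eq_1_imp_nonzero) (simp add: odd_euler_fps_def fps_inf_prod_def)
  ultimately show ?thesis by simp
qed

text \<open>The denominator is already a series in \<open>q^2\<close>, so only the even part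
  \<open>phi(q^2)^2\<close> of \<open>phi^2\<close> is needed.\<close>

lemma v0_multiple_of_4:
  defines "T \<equiv> Abs_fps (\<lambda>n. 2 * v0 (4 * n)) - 1"
  shows "T * phim = phi ^ 2"
proof -
  let ?T = "Abs_fps (\<lambda>n. 2 * v0 (2 * n)) - 1"
  have "?T * fps_dilate 2 phim = fps_dilate 2 (phi ^ 2) + fps_X * fps_dilate 2 (4 * fps_dilate 2 psi ^ 2)"
    unfolding v0_even
    by (subst phi_phim_square) (simp add: fps_dilate_simps mult_ac)
  from fps_section_2_unique(1)[OF this]
  have "fps_section 2 0 ?T * phim = phi ^ 2" .
  moreover have "fps_section 2 0 ?T = T" by (simp add: T_def fps_eq_iff mult.assoc[symmetric])
  ultimately show ?thesis by simp
qed

text \<open>Multiplication by \<open>phi\<close> gives denominator \<open>phi(-q^2)^2\<close> and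
  numerator \<open>phi^3\<close>, whose odd part is taken. The \<open>- 1\<close> sits at exponent 0
  and drops out.\<close>

lemma v0_4_mod_8:
  defines "A \<equiv> fps_dilate 2 phi" and "B \<equiv> fps_dilate 4 psi"
  shows "Abs_fps (\<lambda>n. 2 * v0 (8 * n + 4)) * phim ^ 2 = 6 * A ^ 2 * B + 8 * fps_X * B ^ 3"
proof -
  let ?T = "Abs_fps (\<lambda>n. 2 * v0 (4 * n)) - 1"
  have dissect: "phi = fps_dilate 2 A + 2 * fps_X * fps_dilate 2 B"
    unfolding A_def B_def by (subst phi_dissect) (simp add: fps_dilate_dilate)
  have "?T * fps_dilate 2 (phim ^ 2) = (?T * phim) * phi"
    by (simp add: fps_dilate_power phi_mult_phim[symmetric] mult_ac)
  also have "\<dots> = phi ^ 3" unfolding v0_multiple_of_4 by (simp add: power3_eq_cube power2_eq_square)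
  also have "\<dots> = (fps_dilate 2 A + 2 * fps_X * fps_dilate 2 B) ^ 3" by (simp only: dissect[symmetric])
  also have "\<dots> = fps_dilate 2 (A ^ 3 + 12 * fps_X * A * B ^ 2)
      + fps_X * fps_dilate 2 (6 * A ^ 2 * B + 8 * fps_X * B ^ 3)"
    by (simp only: fps_dilate_simps zero_less_numeral) algebra
  finally have "fps_section 2 1 ?T * phim ^ 2 = 6 * A ^ 2 * B + 8 * fps_X * B ^ 3"
    by (rule fps_section_2_unique)
  moreover have "fps_section 2 1 ?T = Abs_fps (\<lambda>n. 2 * v0 (8 * n + 4))"
    by (simp add: fps_eq_iff algebra_simps)
  ultimately show ?thesis by simp
qed

text \<open>The even part after multiplication by \<open>phi^2\<close>, which makes the denominator
  \<open>phi(-q^2)^4\<close>.\<close>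

lemma v0_4_mod_16:
  defines "b \<equiv> fps_dilate 2 psi"
  shows "Abs_fps (\<lambda>n. 2 * v0 (16 * n + 4)) * phim ^ 4 = 6 * phi ^ 4 * b + 32 * fps_X * b ^ 5"
proof -
  let ?T = "Abs_fps (\<lambda>n. 2 * v0 (8 * n + 4))"
  let ?A = "fps_dilate 2 phi" and ?B = "fps_dilate 4 psi"
  have B: "fps_dilate 2 b = ?B" by (simp add: b_def fps_dilate_dilate)
  have "?T * fps_dilate 2 (phim ^ 4) = ?T * (phi * phim) ^ 2"
    by (simp add: fps_dilate_power phi_mult_phim flip: power_mult)
  also have "\<dots> = (?T * phim ^ 2) * phi ^ 2" by (simp add: power_mult_distrib mult_ac)
  also have "\<dots> = (6 * ?A ^ 2 * ?B + 8 * fps_X * ?B ^ 3) * (?A ^ 2 + 4 * fps_X * ?B ^ 2)"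
    by (simp only: v0_4_mod_8 phi_phim_square(1))
  also have "\<dots> = fps_dilate 2 (6 * phi ^ 4 * b + 32 * fps_X * b ^ 5)
      + fps_X * fps_dilate 2 (32 * phi ^ 2 * b ^ 3)"
    by (simp only: fps_dilate_simps zero_less_numeral B) algebra
  finally have "fps_section 2 0 ?T * phim ^ 4 = 6 * phi ^ 4 * b + 32 * fps_X * b ^ 5"
    by (rule fps_section_2_unique)
  moreover have "fps_section 2 0 ?T = Abs_fps (\<lambda>n. 2 * v0 (16 * n + 4))"
    by (simp add: fps_eq_iff mult.assoc[symmetric])
  ultimately show ?thesis by simp
qed

text \<open>The even part after multiplication by \<open>phi^4\<close>. By
  \<open>phim^4 = a^2 - 16qb^2\<close> and \<open>psi^4 = ab\<close>, subtracting
  \<open>6 * psi\<close> leaves a single multiple of \<open>q psi^9\<close>.\<close>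

lemma v0_4_mod_32:
  "(Abs_fps (\<lambda>n. 2 * v0 (32 * n + 4)) - 6 * psi) * phim ^ 8 = 1024 * fps_X * psi ^ 9"
proof -
  let ?T = "Abs_fps (\<lambda>n. 2 * v0 (16 * n + 4))" and ?U = "Abs_fps (\<lambda>n. 2 * v0 (32 * n + 4))"
  let ?b = "fps_dilate 2 psi"
  define a b where "a = phi ^ 2" and "b = ?b ^ 2"
  have a: "phi ^ 2 = fps_dilate 2 a + 4 * fps_X * fps_dilate 2 b"
    unfolding a_def b_def by (subst phi_phim_square(1)) (simp add: fps_dilate_simps)
  have "?T * fps_dilate 2 (phim ^ 8) = ?T * (phi * phim) ^ 4"
    by (simp add: fps_dilate_power phi_mult_phim flip: power_mult)
  also have "\<dots> = (?T * phim ^ 4) * phi ^ 4" by (simp add: power_mult_distrib mult_ac)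
  also have "\<dots> = 6 * (phi ^ 2) ^ 4 * ?b + 32 * fps_X * (phi ^ 2) ^ 2 * ?b ^ 5"
    unfolding v0_4_mod_16 by algebra
  also have "\<dots> = fps_dilate 2 (6 * psi * (a ^ 4 + 96 * fps_X * a ^ 2 * b ^ 2 + 256 * fps_X ^ 2 * b ^ 4)
        + 256 * fps_X * a * b * psi ^ 5)
      + fps_X * fps_dilate 2 (6 * psi * (16 * a ^ 3 * b + 256 * fps_X * a * b ^ 3)
        + 32 * psi ^ 5 * (a ^ 2 + 16 * fps_X * b ^ 2))"
    unfolding a by (simp only: fps_dilate_simps zero_less_numeral) algebra
  finally have "fps_section 2 0 ?T * phim ^ 8 =
      6 * psi * (a ^ 4 + 96 * fps_X * a ^ 2 * b ^ 2 + 256 * fps_X ^ 2 * b ^ 4) + 256 * fps_X * a * b * psi ^ 5"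
    by (rule fps_section_2_unique)
  moreover have "fps_section 2 0 ?T = ?U"
    by (simp add: fps_eq_iff mult.assoc[symmetric])
  ultimately have U: "?U * phim ^ 8 = 6 * psi * (a ^ 4 + 96 * fps_X * a ^ 2 * b ^ 2 + 256 * fps_X ^ 2 * b ^ 4)
      + 256 * fps_X * a * b * psi ^ 5" by simp
  have phim4: "phim ^ 4 = a ^ 2 - 16 * fps_X * b ^ 2"
    using phi_quartic by (simp add: a_def b_def algebra_simps flip: power_mult)
  have psi4: "psi ^ 4 = a * b"
  proof -
    have "psi ^ 4 = (psi ^ 2) ^ 2" by (simp flip: power_mult)
    then show ?thesis unfolding psi_square by (simp add: a_def b_def power_mult_distrib)
  qed
  have "(?U - 6 * psi) * phim ^ 8 = ?U * phim ^ 8 - 6 * psi * (phim ^ 4) ^ 2"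
    by (simp add: algebra_simps flip: power_mult)
  also have "\<dots> = 6 * psi * (128 * fps_X * (a * b) * (a * b)) + 256 * fps_X * (a * b) * psi ^ 5"
    unfolding U phim4 by algebra
  \<comment> \<open>The constant is \<open>6 * 128 + 256\<close>.\<close>
  also have "\<dots> = 1024 * fps_X * psi ^ 9"
    unfolding psi4[symmetric] by algebra
  finally show ?thesis .
qed

text \<open>Of the 25 Euler factors, 16 turn \<open>phim^8\<close> into its numerator form and 9
  turn \<open>psi^9\<close> into \<open>?F^18\<close>; with the \<open>?F^8\<close> from the former
  this makes 26.\<close>

lemma v0_4_mod_32_euler:
  "(Abs_fps (\<lambda>n. 2 * v0 (32 * n + 4)) - 6 * psi) * euler_fps ^ 25 =
    1024 * fps_X * fps_dilate 2 euler_fps ^ 26"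
proof -
  let ?U = "Abs_fps (\<lambda>n. 2 * v0 (32 * n + 4)) - 6 * psi" and ?F = "fps_dilate 2 euler_fps"
  have "?U * euler_fps ^ 25 = ?U * (euler_fps ^ 2) ^ 8 * euler_fps ^ 9"
    by (simp add: mult.assoc flip: power_mult power_add)
  also have "\<dots> = (?U * phim ^ 8) * ?F ^ 8 * euler_fps ^ 9"
    unfolding phim_mult_euler[symmetric] by (simp add: power_mult_distrib mult_ac)
  also have "\<dots> = 1024 * fps_X * (psi * euler_fps) ^ 9 * ?F ^ 8"
    unfolding v0_4_mod_32 by (simp add: power_mult_distrib mult_ac)
  also have "\<dots> = 1024 * fps_X * ?F ^ 26"
    unfolding psi_mult_euler by (simp add: mult.assoc flip: power_mult power_add)
  finally show ?thesis .
qed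

section \<open>Congruences modulo 5 and 25\<close>

lemma fps_numeral_dvd_iff: "numeral k dvd f \<longleftrightarrow> (\<forall>n. numeral k dvd (f $ n :: int))"
proof
  assume "numeral k dvd f"
  then show "\<forall>n. numeral k dvd f $ n"
    by (auto simp: numeral_fps_const elim!: dvdE)
next
  assume "\<forall>n. numeral k dvd f $ n"
  then have "f = fps_const (numeral k) * Abs_fps (\<lambda>n. f $ n div numeral k)"
    by (simp add: fps_eq_iff)
  then show "numeral k dvd f"
    unfolding numeral_fps_const by (rule dvdI)
qed

text \<open>The Frobenius congruence holds factor by factor for finite products, and each
  coefficient of the limit is attained at a finite stage.\<close>

lemma euler_power_5: "5 dvd euler_fps ^ 5 - fps_dilate 5 euler_fps"
proof -
  have "5 dvd (1 - y) ^ 5 - (1 - y ^ 5)" for y :: "int fps"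
  proof
    show "(1 - y) ^ 5 - (1 - y ^ 5) = 5 * (- y + 2 * y ^ 2 - 2 * y ^ 3 + y ^ 4)"
      by algebra
  qed
  then have dvd: "5 dvd (\<Prod>i<N. (1 - fps_X ^ Suc i) ^ 5) - (\<Prod>i<N. 1 - (fps_X ^ Suc i) ^ 5 :: int fps)" for N
    by (intro prod_diff_dvd) blast
  have "qfac fps_X N ^ 5 = (\<Prod>i<N. (1 - fps_X ^ Suc i) ^ 5 :: int fps)"
    "qfac (fps_X ^ 5) N = (\<Prod>i<N. 1 - (fps_X ^ Suc i) ^ 5 :: int fps)" for N
    by (simp_all only: qfac_def prod_power_distrib power_mult[symmetric] mult.commute)
  with dvd have dvd: "5 dvd qfac fps_X N ^ 5 - (qfac (fps_X ^ 5) N :: int fps)" for N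
    by simp
  have "(\<lambda>N. qfac fps_X N ^ 5 + (- 1) * qfac (fps_X ^ 5) N) \<longlonglongrightarrow>
      euler_fps ^ 5 + (- 1) * fps_dilate 5 euler_fps"
    by (intro tendsto_fps_add tendsto_fps_mult tendsto_const tendsto_fps_power tendsto_qfac
        tendsto_qfac_X_power) simp
  then have "\<exists>N. (qfac fps_X N ^ 5 - qfac (fps_X ^ 5) N) $ n = (euler_fps ^ 5 - fps_dilate 5 euler_fps) $ n" for n
    unfolding tendsto_fps_iff using eventually_happens'[OF sequentially_bot] by fastforce
  then show ?thesis
    using dvd unfolding fps_numeral_dvd_iff by metis
qed

text \<open>Fifth powers lift a congruence modulo 5 to one modulo 25.\<close>

lemma euler_power_25: "25 dvd euler_fps ^ 25 - fps_dilate 5 (euler_fps ^ 5)"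
proof -
  obtain h where h: "euler_fps ^ 5 = fps_dilate 5 euler_fps + 5 * h"
    using euler_power_5 by (metis diff_add_cancel add.commute dvdE)
  have "(f + 5 * h) ^ 5 - f ^ 5 =
      25 * (f ^ 4 * h + 10 * f ^ 3 * h ^ 2 + 50 * f ^ 2 * h ^ 3 + 125 * f * h ^ 4 + 125 * h ^ 5)" for f :: "int fps"
    by algebra
  from this[of "fps_dilate 5 euler_fps"]
  have "25 dvd (euler_fps ^ 5) ^ 5 - fps_dilate 5 euler_fps ^ 5"
    unfolding h by (metis dvd_triv_left)
  then show ?thesis by (simp add: fps_dilate_power flip: power_mult)
qed

theorem theorem5p3:
  fixes n r :: nat
  assumes "r \<in> {68, 132}"
  shows "[v0 (160 * n + r) = 0] (mod 25)"
proof -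
  define U where "U = Abs_fps (\<lambda>n. 2 * v0 (32 * n + 4)) - 6 * psi"
  define F where "F = fps_dilate 2 euler_fps"
  \<comment> \<open>With \<open>r = 32 * s + 4\<close>, the index \<open>160 * n + r\<close> is
    \<open>32 * (5 * n + s) + 4\<close>.\<close>
  define s where "s = (r - 4) div 32"
  have s: "s = 2 \<or> s = 4" and r: "r = 32 * s + 4" using assms by (auto simp: s_def)
  have "25 dvd fps_dilate 2 (euler_fps ^ 25 - fps_dilate 5 (euler_fps ^ 5))"
    using euler_power_25 unfolding fps_numeral_dvd_iff by (simp add: fps_dilate_nth)
  then have F: "25 dvd F ^ 25 - fps_dilate 5 (F ^ 5)"
    by (simp add: F_def fps_dilate_simps)
  \<comment> \<open>Both 25th powers are replaced by series in \<open>q^5\<close>, at the cost of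
    multiples of 25.\<close>
  have "U * fps_dilate 5 (euler_fps ^ 5) - 1024 * fps_X * F * fps_dilate 5 (F ^ 5) =
      1024 * fps_X * F * (F ^ 25 - fps_dilate 5 (F ^ 5))
      - U * (euler_fps ^ 25 - fps_dilate 5 (euler_fps ^ 5))
      + (U * euler_fps ^ 25 - 1024 * fps_X * F ^ 26)"
    by algebra
  also have "U * euler_fps ^ 25 - 1024 * fps_X * F ^ 26 = 0"
    unfolding U_def F_def v0_4_mod_32_euler by simp
  finally have "25 dvd U * fps_dilate 5 (euler_fps ^ 5) - 1024 * fps_X * F * fps_dilate 5 (F ^ 5)"
    using F euler_power_25 by (metis add.right_neutral dvd_diff dvd_mult)
  then have "25 dvd fps_section 5 s (U * fps_dilate 5 (euler_fps ^ 5))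
      - fps_section 5 s (1024 * fps_X * F * fps_dilate 5 (F ^ 5))"
    unfolding fps_numeral_dvd_iff by simp
  also have "fps_section 5 s (U * fps_dilate 5 (euler_fps ^ 5)) = fps_section 5 s U * euler_fps ^ 5"
    using s by (intro fps_section_mult_dilate) auto
  also have "fps_section 5 s (1024 * fps_X * F * fps_dilate 5 (F ^ 5)) =
      fps_section 5 s (1024 * fps_X * F) * F ^ 5"
    using s by (intro fps_section_mult_dilate) auto
  also have "fps_section 5 s (1024 * fps_X * F) = 0"
  proof (rule fps_ext)
    fix m
    \<comment> \<open>The factor \<open>q\<close> lowers the exponent by 1. If
      \<open>2j = 5m + s - 1\<close>, then \<open>j\<close> is 3 modulo 5 for \<open>s = 2\<close>
      and 4 for \<open>s = 4\<close>, where the Euler product has no terms.\<close>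
    have "F $ (5 * m + s - 1) = 0"
    proof (cases "even (5 * m + s - 1)")
      case True
      then obtain j where j: "5 * m + s - 1 = 2 * j" by (elim evenE)
      then have "j mod 5 = 3 \<or> j mod 5 = 4" using s by presburger
      then show ?thesis unfolding F_def j by (auto simp: fps_dilate_nth intro: euler_support)
    qed (simp add: F_def fps_dilate_nth)
    then show "fps_section 5 s (1024 * fps_X * F) $ m = 0 $ m"
      using s by (simp add: numeral_fps_const mult.assoc)
  qed
  finally have "25 dvd fps_section 5 s U * euler_fps ^ 5" by simp
  \<comment> \<open>The power of the Euler product has constant term 1, so it can be divided out
    over the integers.\<close>
  then have "25 dvd fps_section 5 s U * euler_fps ^ 5 * fps_right_inverse (euler_fps ^ 5) 1"
    by (rule dvd_mult2)
  also have "\<dots> = fps_section 5 s U"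
    using fps_right_inverse_1[of "euler_fps ^ 5"] by (simp add: mult.assoc fps_power_zeroth)
  finally have "25 dvd U $ (5 * n + s)"
    unfolding fps_numeral_dvd_iff by simp
  moreover have "psi $ (5 * n + s) = 0"
    using s by (intro psi_support) auto
  then have "U $ (5 * n + s) = 2 * v0 (160 * n + r)"
    unfolding U_def numeral_fps_const by (simp add: r algebra_simps)
  ultimately have "25 dvd 2 * v0 (160 * n + r)" by simp
  then have "25 dvd v0 (160 * n + r)" by presburger
  then show ?thesis by (simp add: cong_0_iff)
qed

end
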